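(* Let $e\geq 2$ be an integer. Let $K$ be a finite commutative ring with identity having precisely three ideals: $\langle 0\rangle$, $J$ and $K$. Let $K/J\cong \mathbb{F}_q$, where $\mathbb{F}_q$ is a finite field of order $q$ for a prime power $q$. Then the graph $Y(2e,K)$ is a divisible design graph with parameters $(v,k,\lambda_1,\lambda_2,m,n)$ where $v=\frac{q^{2e-1}(q^{2e}-1)}{q-1}$, $k=q^{4e-3}-q^{2e-2}$, $\lambda_1=q^{4e-3}-q^{4e-4}-q^{2e-2}$, $\lambda_2=q^{4e-4}-q^{4e-5}-q^{2e-2}+q^{2e-3}$, $m=\frac{q^{2e}-1}{q-1}$, $n=q^{2e-1}$.
   Context: A divisible design graph with parameters $(v,k,\lambda_1,\lambda_2,m,n)$ is a $k$-regular graph on $v$ vertices whose vertex set can be partitioned into $m$ classes of size $n$ such that any two distinct vertices in the same class have exactly $\lambda_1$ common neighbours and any two vertices in different classes have exactly $\lambda_2$ common neighbours. Let $K^\times$ be the set of units of $K$. Let $V'$ be the set of tuples $(a_1,\ldots,a_{2e})\in K^{2e}$ having at least one entry in $K^\times$. Two tuples $a,b\in V'$ are equivalent if $a=\lambda b$ for some $\lambda\in K^\times$; write $[a]$ for the class of $a$ and let $V$ be the set of classes. For $a,b\in K^{2e}$ put $\langle a,b\rangle=\sum_{i=1}^{e}(a_ib_{e+i}-a_{e+i}b_i)$ (i.e. $aMb^t$ with $M=\begin{bmatrix}0&I_e\\-I_e&0\end{bmatrix}$). The graph $Y(2e,K)$ has vertex set $V$, with $[a]$ adjacent to $[b]$ iff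 $\langle a,b\rangle\in J\setminus\{0\}$. *)

theory Defs
  imports
    "HOL-Algebra.Ring"
    "HOL-Algebra.QuotRing"
    "HOL-Number_Theory.Prime_Powers"
    "HOL-Library.Disjoint_Sets"
    "HOL-Library.FuncSet"
    "Graph_Theory.Pair_Digraph"
begin

text \<open>
  A finite simple graph is a \<^const>\<open>pair_graph\<close>: a finite, loop-free and symmetric
  set of arcs on a finite vertex set, each edge being represented by its two arcs.
\<close>

definition neighbours :: "'a pair_pre_digraph \<Rightarrow> 'a \<Rightarrow> 'a set" where
  "neighbours G x = {y \<in> pverts G. (x, y) \<in> parcs G}"

definition divisible_design_graph ::
    "'a pair_pre_digraph \<Rightarrow> nat \<Rightarrow> nat \<Rightarrow> nat \<Rightarrow> nat \<Rightarrow> nat \<Rightarrow> nat \<Rightarrow> bool" where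
  "divisible_design_graph G v k l1 l2 m n \<longleftrightarrow>
     pair_graph G \<and>
     card (pverts G) = v \<and>
     (\<forall>x \<in> pverts G. card (neighbours G x) = k) \<and>
     (\<exists>P. partition_on (pverts G) P \<and> card P = m \<and> (\<forall>C \<in> P. card C = n) \<and>
        (\<forall>C \<in> P. \<forall>x \<in> C. \<forall>y \<in> C. x \<noteq> y \<longrightarrow>
           card (neighbours G x \<inter> neighbours G y) = l1) \<and>
        (\<forall>C \<in> P. \<forall>D \<in> P. C \<noteq> D \<longrightarrow> (\<forall>x \<in> C. \<forall>y \<in> D.
           card (neighbours G x \<inter> neighbours G y) = l2)))"

definition tuples :: "nat \<Rightarrow> ('a, 'c) ring_scheme \<Rightarrow> (nat \<Rightarrow> 'a) set" where
  "tuples d K = {1..d} \<rightarrow>\<^sub>E carrier K"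

definition unit_tuples :: "nat \<Rightarrow> ('a, 'c) ring_scheme \<Rightarrow> (nat \<Rightarrow> 'a) set" where
  "unit_tuples d K = {a \<in> tuples d K. \<exists>i \<in> {1..d}. a i \<in> Units K}"

definition unit_multiple :: "nat \<Rightarrow> ('a, 'c) ring_scheme \<Rightarrow> ((nat \<Rightarrow> 'a) \<times> (nat \<Rightarrow> 'a)) set" where
  "unit_multiple d K =
     {(a, b). a \<in> unit_tuples d K \<and> b \<in> unit_tuples d K \<and>
        (\<exists>u \<in> Units K. a = (\<lambda>i \<in> {1..d}. u \<otimes>\<^bsub>K\<^esub> b i))}"

definition tuple_class :: "nat \<Rightarrow> ('a, 'c) ring_scheme \<Rightarrow> (nat \<Rightarrow> 'a) \<Rightarrow> (nat \<Rightarrow> 'a) set" where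
  "tuple_class d K a = unit_multiple d K `` {a}"

definition symplectic_form ::
    "nat \<Rightarrow> ('a, 'c) ring_scheme \<Rightarrow> (nat \<Rightarrow> 'a) \<Rightarrow> (nat \<Rightarrow> 'a) \<Rightarrow> 'a" where
  "symplectic_form e K a b =
     (\<Oplus>\<^bsub>K\<^esub> i \<in> {1..e}. a i \<otimes>\<^bsub>K\<^esub> b (e + i) \<ominus>\<^bsub>K\<^esub> a (e + i) \<otimes>\<^bsub>K\<^esub> b i)"

text \<open>
  The first argument \<open>e\<close> is half the tuple length. Replacing representatives multiplies the
  form by a unit, and an ideal \<open>J\<close> minus zero is closed under that, so the choice of
  representatives in the set of arcs is immaterial.
\<close>

definition Y_graph ::
    "nat \<Rightarrow> ('a, 'c) ring_scheme \<Rightarrow> 'a set \<Rightarrow> (nat \<Rightarrow> 'a) set pair_pre_digraph" where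
  "Y_graph e K J =
     \<lparr> pverts = unit_tuples (2 * e) K // unit_multiple (2 * e) K,
       parcs = {(tuple_class (2 * e) K a, tuple_class (2 * e) K b) | a b.
                  a \<in> unit_tuples (2 * e) K \<and> b \<in> unit_tuples (2 * e) K \<and>
                  symplectic_form e K a b \<in> J - {\<zero>\<^bsub>K\<^esub>}} \<rparr>"

end

theory Submission
  imports Defs
begin

text \<open>
  \<open>K\<close> is a local ring with \<open>J\<^sup>2 = 0\<close>, \<open>|J| = q\<close> and \<open>|K| = q\<^sup>2\<close>, and \<open>J = wK\<close> for every nonzero
  \<open>w \<in> J\<close>. If \<open>a\<close> and \<open>c\<close> are linearly independent modulo \<open>J\<close>, then
  \<open>x \<mapsto> (\<langle>a, x\<rangle>, \<langle>c, x\<rangle>)\<close> maps \<open>K\<^sup>2\<^sup>e\<close> onto \<open>K\<^sup>2\<close> and \<open>J\<^sup>2\<^sup>e\<close> onto \<open>J\<^sup>2\<close>, both times with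
  fibres of constant size. Since \<open>V'\<close> is the complement of \<open>J\<^sup>2\<^sup>e\<close> in \<open>K\<^sup>2\<^sup>e\<close> and the \<open>q\<^sup>2 - q\<close> units act
  freely on it, every count of common neighbours is a difference of two such fibre counts, divided by
  \<open>q\<^sup>2 - q\<close>. The classes of the design are the points of the projective space over \<open>K/J\<close>.
  Vertices in different classes have representatives that are independent modulo \<open>J\<close>; two distinct
  vertices of one class are \<open>[a]\<close> and \<open>[a + wc]\<close> with \<open>a\<close>, \<open>c\<close> independent modulo \<open>J\<close>, and
  \<open>\<langle>a + wc, x\<rangle> = \<langle>a, x\<rangle> + w\<langle>c, x\<rangle>\<close> reduces that case to the same count.
\<close>

section \<open>Counting by fibres\<close>

lemma card_vimage_equal_fibres:
  assumes "finite X" and "finite S"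
    and "\<And>y. y \<in> S \<Longrightarrow> card {x \<in> X. f x = y} = N"
  shows "card {x \<in> X. f x \<in> S} = card S * N"
proof -
  have "{x \<in> X. f x \<in> S} = (\<Union>y\<in>S. {x \<in> X. f x = y})" by auto
  then have "card {x \<in> X. f x \<in> S} = (\<Sum>y\<in>S. card {x \<in> X. f x = y})"
    using assms by (simp add: card_UN_disjoint' disjoint_family_on_def disjoint_iff)
  then show ?thesis using assms(3) by simp
qed

lemma card_image_equal_fibres:
  assumes "finite X" and "\<And>x. x \<in> X \<Longrightarrow> card {x' \<in> X. f x' = f x} = N"
  shows "card X = card (f ` X) * N"
proof -
  have "card {x \<in> X. f x \<in> f ` X} = card (f ` X) * N"
    by (rule card_vimage_equal_fibres) (use assms in auto)
  moreover have "{x \<in> X. f x \<in> f ` X} = X" by auto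
  ultimately show ?thesis by simp
qed

section \<open>Tuples and linear forms over a commutative ring\<close>

definition vadd :: "nat \<Rightarrow> ('a, 'c) ring_scheme \<Rightarrow> (nat \<Rightarrow> 'a) \<Rightarrow> (nat \<Rightarrow> 'a) \<Rightarrow> nat \<Rightarrow> 'a" where
  "vadd d K a b = (\<lambda>i\<in>{1..d}. a i \<oplus>\<^bsub>K\<^esub> b i)"

definition smul :: "nat \<Rightarrow> ('a, 'c) ring_scheme \<Rightarrow> 'a \<Rightarrow> (nat \<Rightarrow> 'a) \<Rightarrow> nat \<Rightarrow> 'a" where
  "smul d K u a = (\<lambda>i\<in>{1..d}. u \<otimes>\<^bsub>K\<^esub> a i)"

definition dot :: "nat \<Rightarrow> ('a, 'c) ring_scheme \<Rightarrow> (nat \<Rightarrow> 'a) \<Rightarrow> (nat \<Rightarrow> 'a) \<Rightarrow> 'a" where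
  "dot d K a x = (\<Oplus>\<^bsub>K\<^esub> i \<in> {1..d}. a i \<otimes>\<^bsub>K\<^esub> x i)"

text \<open>This is the column \<open>M x^t\<close> for the matrix \<open>M\<close> of the
  symplectic form. Composing with it turns the form into the plain product \<open>dot\<close>, so
  that all counting can be done for arbitrary linear forms.\<close>

definition twist :: "nat \<Rightarrow> ('a, 'c) ring_scheme \<Rightarrow> (nat \<Rightarrow> 'a) \<Rightarrow> nat \<Rightarrow> 'a" where
  "twist e K x = (\<lambda>i\<in>{1..2*e}. if i \<le> e then x (e + i) else \<ominus>\<^bsub>K\<^esub> x (i - e))"

\<comment> \<open>Otherwise the index sets \<open>{1..d}\<close> get rewritten to \<open>{Suc 0..d}\<close>, which no lemma below matches.\<close>
declare One_nat_def [simp del]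

context cring
begin

lemma dot_closed:
  assumes "a \<in> tuples d R" "x \<in> tuples d R"
  shows "dot d R a x \<in> carrier R"
  using assms unfolding dot_def tuples_def by (intro finsum_closed) auto

lemma dot_in_ideal:
  assumes "ideal M R" "a \<in> tuples d R" "x \<in> {1..d} \<rightarrow>\<^sub>E M"
  shows "dot d R a x \<in> M"
proof -
  interpret M: ideal M R by fact
  have "A \<subseteq> {1..d} \<Longrightarrow> (\<Oplus> i \<in> A. a i \<otimes> x i) \<in> M" if "finite A" for A
    using that
  proof (induction A)
    case (insert i A)
    have "\<And>j. j \<in> {1..d} \<Longrightarrow> a j \<otimes> x j \<in> M"
      using assms by (auto simp: tuples_def intro!: M.I_l_closed)
    moreover from this have "(\<lambda>j. a j \<otimes> x j) \<in> A \<rightarrow> carrier R" "a i \<otimes> x i \<in> carrier R"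
      using insert.prems M.a_subset by auto
    ultimately show ?case using insert by simp
  qed simp
  then show ?thesis unfolding dot_def by simp
qed

lemma dot_vadd:
  assumes "a \<in> tuples d R" "x \<in> tuples d R" "y \<in> tuples d R"
  shows "dot d R a (vadd d R x y) = dot d R a x \<oplus> dot d R a y"
proof -
  have c: "\<And>i. i \<in> {1..d} \<Longrightarrow> a i \<in> carrier R"
      "\<And>i. i \<in> {1..d} \<Longrightarrow> x i \<in> carrier R"
      "\<And>i. i \<in> {1..d} \<Longrightarrow> y i \<in> carrier R"
    using assms by (auto simp: tuples_def)
  have "dot d R a (vadd d R x y) = (\<Oplus> i \<in> {1..d}. a i \<otimes> x i \<oplus> a i \<otimes> y i)"
    unfolding dot_def vadd_def
    using c by (intro finsum_cong') (auto simp: r_distr)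
  also have "\<dots> = dot d R a x \<oplus> dot d R a y"
    unfolding dot_def using assms by (intro finsum_addf) (auto simp: tuples_def)
  finally show ?thesis .
qed

lemma dot_vadd_left:
  assumes "a \<in> tuples d R" "b \<in> tuples d R" "x \<in> tuples d R"
  shows "dot d R (vadd d R a b) x = dot d R a x \<oplus> dot d R b x"
proof -
  have c: "\<And>i. i \<in> {1..d} \<Longrightarrow> a i \<in> carrier R"
      "\<And>i. i \<in> {1..d} \<Longrightarrow> b i \<in> carrier R"
      "\<And>i. i \<in> {1..d} \<Longrightarrow> x i \<in> carrier R"
    using assms by (auto simp: tuples_def)
  have "dot d R (vadd d R a b) x = (\<Oplus> i \<in> {1..d}. a i \<otimes> x i \<oplus> b i \<otimes> x i)"
    unfolding dot_def vadd_def
    using c by (intro finsum_cong') (auto simp: l_distr)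
  also have "\<dots> = dot d R a x \<oplus> dot d R b x"
    unfolding dot_def using assms by (intro finsum_addf) (auto simp: tuples_def)
  finally show ?thesis .
qed

lemma dot_smul_left:
  assumes "u \<in> carrier R" "a \<in> tuples d R" "x \<in> tuples d R"
  shows "dot d R (smul d R u a) x = u \<otimes> dot d R a x"
proof -
  have c: "\<And>i. i \<in> {1..d} \<Longrightarrow> a i \<in> carrier R" "\<And>i. i \<in> {1..d} \<Longrightarrow> x i \<in> carrier R"
    using assms by (auto simp: tuples_def)
  have "dot d R (smul d R u a) x = (\<Oplus> i \<in> {1..d}. u \<otimes> (a i \<otimes> x i))"
    unfolding dot_def smul_def
    using c assms(1) by (intro finsum_cong') (auto simp: m_assoc)
  also have "\<dots> = u \<otimes> dot d R a x"
    unfolding dot_def using assms by (intro finsum_rdistr[symmetric]) (auto simp: tuples_def)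
  finally show ?thesis .
qed

lemma dot_single:
  assumes "a \<in> tuples d R" "i \<in> {1..d}" "s \<in> carrier R"
  shows "dot d R a (\<lambda>l\<in>{1..d}. if i = l then s else \<zero>) = a i \<otimes> s"
proof -
  have c: "\<And>i. i \<in> {1..d} \<Longrightarrow> a i \<in> carrier R"
    using assms by (auto simp: tuples_def)
  have "dot d R a (\<lambda>l\<in>{1..d}. if i = l then s else \<zero>)
      = (\<Oplus> l \<in> {1..d}. if i = l then a l \<otimes> s else \<zero>)"
    unfolding dot_def using c assms by (intro finsum_cong') auto
  also have "\<dots> = a i \<otimes> s"
    using assms by (intro finsum_singleton) (auto simp: tuples_def)
  finally show ?thesis .
qed

section \<open>The symplectic form and its symmetries\<close>

lemma symplectic_form_eq_dot_twist:
  assumes "a \<in> tuples (2 * e) R" "x \<in> tuples (2 * e) R"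
  shows "symplectic_form e R a x = dot (2 * e) R a (twist e R x)"
proof -
  let ?f = "\<lambda>i. a i \<otimes> twist e R x i"
  have c: "a i \<in> carrier R" "x i \<in> carrier R" if "i \<in> {1..2*e}" for i
    using assms that by (auto simp: tuples_def)
  have f: "?f i \<in> carrier R" if "i \<in> {1..2*e}" for i
    using that c[of i] c(2)[of "e + i"] c(2)[of "i - e"] by (auto simp: twist_def One_nat_def Suc_le_eq)
  \<comment> \<open>The index range is cut into its two halves. After shifting the second half, the
    terms at \<open>i\<close> and \<open>e + i\<close> add up to one summand of the symplectic
    form.\<close>
  have split: "{1..2*e} = {1..e} \<union> (\<lambda>i. e + i) ` {1..e}"
  proof -
    have "i \<in> (\<lambda>i. e + i) ` {1..e}" if "i \<in> {1..2*e}" "i \<notin> {1..e}" for i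
      using that by (intro image_eqI[of _ _ "i - e"]) auto
    then show ?thesis by auto
  qed
  have "dot (2 * e) R a (twist e R x) = finsum R ?f {1..e} \<oplus> finsum R ?f ((\<lambda>i. e + i) ` {1..e})"
    unfolding dot_def split using f by (intro finsum_Un_disjoint) auto
  also have "finsum R ?f ((\<lambda>i. e + i) ` {1..e}) = (\<Oplus> i \<in> {1..e}. ?f (e + i))"
    using f by (intro finsum_reindex) auto
  also have "finsum R ?f {1..e} \<oplus> (\<Oplus> i \<in> {1..e}. ?f (e + i)) = (\<Oplus> i \<in> {1..e}. ?f i \<oplus> ?f (e + i))"
    using f by (intro finsum_addf[symmetric]) auto
  also have "\<dots> = symplectic_form e R a x"
    unfolding symplectic_form_def using c
    by (intro finsum_cong') (auto simp: twist_def minus_eq r_minus)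
  finally show ?thesis by simp
qed

text \<open>The twist permutes coordinates up to sign, which keeps all entries inside any given
  ideal. The counts apply this both to the whole ring and to \<open>J\<close>.\<close>

lemma twist_bij:
  assumes "ideal M R"
  shows "bij_betw (twist e R) ({1..2*e} \<rightarrow>\<^sub>E M) ({1..2*e} \<rightarrow>\<^sub>E M)"
proof -
  interpret M: ideal M R by fact
  \<comment> \<open>The matrix of the form squares to \<open>-I\<close>, so the inverse of the twist
    is its negative.\<close>
  let ?g = "\<lambda>y. (\<lambda>i\<in>{1..2*e}. if i \<le> e then \<ominus> y (e + i) else y (i - e))"
  have sub: "\<And>x. x \<in> M \<Longrightarrow> x \<in> carrier R" using M.a_subset by auto
  show ?thesis
  proof (rule bij_betw_byWitness[where f' = ?g])
    show "\<forall>x \<in> {1..2*e} \<rightarrow>\<^sub>E M. ?g (twist e R x) = x"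
      by (auto simp: twist_def fun_eq_iff PiE_def extensional_def Pi_def sub)
    show "\<forall>y \<in> {1..2*e} \<rightarrow>\<^sub>E M. twist e R (?g y) = y"
      by (auto simp: twist_def fun_eq_iff PiE_def extensional_def Pi_def sub)
    show "twist e R ` ({1..2*e} \<rightarrow>\<^sub>E M) \<subseteq> {1..2*e} \<rightarrow>\<^sub>E M"
      by (auto simp: twist_def PiE_def Pi_def One_nat_def Suc_le_eq)
    show "?g ` ({1..2*e} \<rightarrow>\<^sub>E M) \<subseteq> {1..2*e} \<rightarrow>\<^sub>E M"
      by (auto simp: PiE_def Pi_def One_nat_def Suc_le_eq)
  qed
qed

lemma symplectic_form_smul:
  assumes "u \<in> carrier R" "v \<in> carrier R" "a \<in> tuples (2 * e) R" "b \<in> tuples (2 * e) R"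
  shows "symplectic_form e R (smul (2 * e) R u a) (smul (2 * e) R v b)
    = u \<otimes> v \<otimes> symplectic_form e R a b"
proof -
  have c: "a i \<in> carrier R" "b i \<in> carrier R" if "i \<in> {1..2*e}" for i
    using assms that by (auto simp: tuples_def)
  have "symplectic_form e R (smul (2 * e) R u a) (smul (2 * e) R v b)
    = (\<Oplus> i \<in> {1..e}. u \<otimes> v \<otimes> (a i \<otimes> b (e + i) \<ominus> a (e + i) \<otimes> b i))"
    unfolding symplectic_form_def
  proof (intro finsum_cong' funcsetI refl)
    fix i assume i: "i \<in> {1..e}"
    then have "a i \<in> carrier R" "a (e + i) \<in> carrier R" "b i \<in> carrier R" "b (e + i) \<in> carrier R"
      using c by auto
    then show "smul (2 * e) R u a i \<otimes> smul (2 * e) R v b (e + i) \<ominus>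
        smul (2 * e) R u a (e + i) \<otimes> smul (2 * e) R v b i =
      u \<otimes> v \<otimes> (a i \<otimes> b (e + i) \<ominus> a (e + i) \<otimes> b i)"
      using i assms by (simp add: smul_def) algebra
  qed (use c assms in auto)
  also have "\<dots> = u \<otimes> v \<otimes> symplectic_form e R a b"
    unfolding symplectic_form_def using c assms by (intro finsum_rdistr[symmetric]) auto
  finally show ?thesis .
qed

lemma symplectic_form_swap:
  assumes "a \<in> tuples (2 * e) R" "b \<in> tuples (2 * e) R"
  shows "symplectic_form e R b a = \<ominus> symplectic_form e R a b"
proof -
  have c: "a i \<in> carrier R" "b i \<in> carrier R" if "i \<in> {1..2*e}" for i
    using assms that by (auto simp: tuples_def)
  have "symplectic_form e R b a \<oplus> symplectic_form e R a b
     = (\<Oplus> i \<in> {1..e}. (b i \<otimes> a (e + i) \<ominus> b (e + i) \<otimes> a i) \<oplus> (a i \<otimes> b (e + i) \<ominus> a (e + i) \<otimes> b i))"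
    unfolding symplectic_form_def using c by (intro finsum_addf[symmetric]) auto
  also have "\<dots> = \<zero>"
  proof (rule add.finprod_one_eqI)
    fix i assume i: "i \<in> {1..e}"
    then have "a i \<in> carrier R" "a (e + i) \<in> carrier R" "b i \<in> carrier R" "b (e + i) \<in> carrier R"
      using c by auto
    then show "(b i \<otimes> a (e + i) \<ominus> b (e + i) \<otimes> a i) \<oplus> (a i \<otimes> b (e + i) \<ominus> a (e + i) \<otimes> b i) = \<zero>"
      by algebra
  qed
  finally show ?thesis
    using c by (intro sum_zero_eq_neg) (auto simp: symplectic_form_def intro!: finsum_closed)
qed

lemma symplectic_form_self:
  assumes "a \<in> tuples (2 * e) R"
  shows "symplectic_form e R a a = \<zero>"
  unfolding symplectic_form_def
proof (rule add.finprod_one_eqI)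
  fix i assume "i \<in> {1..e}"
  then have "a i \<in> carrier R" "a (e + i) \<in> carrier R"
    using assms by (auto simp: tuples_def)
  then show "a i \<otimes> a (e + i) \<ominus> a (e + i) \<otimes> a i = \<zero>" by algebra
qed

section \<open>Fibres of one and of two linear forms\<close>

lemma card_dot_fibre:
  assumes M: "ideal M R" and a: "a \<in> tuples d R" "c \<in> tuples d R" and x0: "x0 \<in> {1..d} \<rightarrow>\<^sub>E M"
  shows "card {x \<in> {1..d} \<rightarrow>\<^sub>E M. (dot d R a x, dot d R c x) = (dot d R a x0, dot d R c x0)}
    = card {x \<in> {1..d} \<rightarrow>\<^sub>E M. (dot d R a x, dot d R c x) = (\<zero>, \<zero>)}"
proof -
  interpret M: ideal M R by fact
  have sub: "\<And>x. x \<in> M \<Longrightarrow> x \<in> carrier R" using M.a_subset by auto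
  \<comment> \<open>The pair of forms is additive, so translation by \<open>x0\<close> carries its
    kernel onto the fibre through \<open>x0\<close>; \<open>?n\<close> is \<open>-x0\<close> and
    translates back.\<close>
  let ?n = "\<lambda>i\<in>{1..d}. \<ominus> x0 i"
  have n: "?n \<in> {1..d} \<rightarrow>\<^sub>E M" using x0 by auto
  have add: "vadd d R x y \<in> {1..d} \<rightarrow>\<^sub>E M" if "x \<in> {1..d} \<rightarrow>\<^sub>E M" "y \<in> {1..d} \<rightarrow>\<^sub>E M" for x y
    using that by (auto simp: vadd_def)
  have tup: "\<And>x. x \<in> {1..d} \<rightarrow>\<^sub>E M \<Longrightarrow> x \<in> tuples d R" using sub by (fastforce simp: tuples_def PiE_iff)
  have inv1: "vadd d R (vadd d R x x0) ?n = x" if "x \<in> {1..d} \<rightarrow>\<^sub>E M" for x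
  proof
    fix i show "vadd d R (vadd d R x x0) ?n i = x i"
    proof (cases "i \<in> {1..d}")
      case True
      then have "x i \<in> carrier R" "x0 i \<in> carrier R" using that x0 sub PiE_mem by metis+
      then show ?thesis using True by (simp add: vadd_def a_assoc r_neg)
    qed (use that in \<open>auto simp: vadd_def PiE_def extensional_def\<close>)
  qed
  have inv2: "vadd d R (vadd d R x ?n) x0 = x" if "x \<in> {1..d} \<rightarrow>\<^sub>E M" for x
  proof
    fix i show "vadd d R (vadd d R x ?n) x0 i = x i"
    proof (cases "i \<in> {1..d}")
      case True
      then have "x i \<in> carrier R" "x0 i \<in> carrier R" using that x0 sub PiE_mem by metis+
      then show ?thesis using True by (simp add: vadd_def a_assoc l_neg)
    qed (use that in \<open>auto simp: vadd_def PiE_def extensional_def\<close>)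
  qed
  have dn: "dot d R b (vadd d R x ?n) = \<zero>"
    if "b \<in> tuples d R" "x \<in> {1..d} \<rightarrow>\<^sub>E M" "dot d R b x = dot d R b x0" for b x
  proof -
    \<comment> \<open>Only the value of the form \<open>b\<close> at \<open>x\<close> enters, so
      \<open>x\<close> may be exchanged for \<open>x0\<close>; then every coordinate
      cancels.\<close>
    have "dot d R b (vadd d R x ?n) = dot d R b x0 \<oplus> dot d R b ?n"
      using that n by (simp add: dot_vadd tup del: restrict_PiE_iff)
    also have "\<dots> = dot d R b (vadd d R x0 ?n)"
      using that n x0 by (simp add: dot_vadd tup del: restrict_PiE_iff)
    also have "\<dots> = \<zero>"
      unfolding dot_def
    proof (rule add.finprod_one_eqI)
      fix i assume "i \<in> {1..d}"
      then have "b i \<in> carrier R" "x0 i \<in> carrier R" using that x0 sub PiE_mem unfolding tuples_def by metis+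
      then show "b i \<otimes> vadd d R x0 ?n i = \<zero>" using \<open>i \<in> {1..d}\<close> by (simp add: vadd_def r_neg)
    qed
    finally show ?thesis .
  qed
  have "bij_betw (\<lambda>x. vadd d R x x0)
      {x \<in> {1..d} \<rightarrow>\<^sub>E M. (dot d R a x, dot d R c x) = (\<zero>, \<zero>)}
      {x \<in> {1..d} \<rightarrow>\<^sub>E M. (dot d R a x, dot d R c x) = (dot d R a x0, dot d R c x0)}"
  proof (rule bij_betw_byWitness[where f' = "\<lambda>x. vadd d R x ?n"])
    show "(\<lambda>x. vadd d R x x0) ` {x \<in> {1..d} \<rightarrow>\<^sub>E M. (dot d R a x, dot d R c x) = (\<zero>, \<zero>)}
      \<subseteq> {x \<in> {1..d} \<rightarrow>\<^sub>E M. (dot d R a x, dot d R c x) = (dot d R a x0, dot d R c x0)}"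
      using add[OF _ x0] a x0 by (auto simp: dot_vadd tup dot_closed)
    show "(\<lambda>x. vadd d R x ?n) `
        {x \<in> {1..d} \<rightarrow>\<^sub>E M. (dot d R a x, dot d R c x) = (dot d R a x0, dot d R c x0)}
      \<subseteq> {x \<in> {1..d} \<rightarrow>\<^sub>E M. (dot d R a x, dot d R c x) = (\<zero>, \<zero>)}"
      using add[OF _ n] dn[OF a(1)] dn[OF a(2)] by blast
  qed (use inv1 inv2 in blast)+
  then show ?thesis by (rule bij_betw_same_card[symmetric])
qed

text \<open>Triangular system: \<open>s\<close> is solved for in coordinate \<open>i\<close> after the multiple of \<open>a\<close>
  that clears coordinate \<open>i\<close> of \<open>c\<close> has been subtracted.\<close>

lemma dot_pair_surj:
  assumes M: "ideal M R" and a: "a \<in> tuples d R" and c: "c \<in> tuples d R"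
    and i: "i \<in> {1..d}" "a i \<in> Units R" 
    and k: "k \<in> {1..d}" "c k \<ominus> c i \<otimes> inv (a i) \<otimes> a k \<in> Units R"
    and st: "s \<in> M" "t \<in> M"
  shows "\<exists>x \<in> {1..d} \<rightarrow>\<^sub>E M. dot d R a x = s \<and> dot d R c x = t"
proof -
  interpret M: ideal M R by fact
  have sub: "\<And>x. x \<in> M \<Longrightarrow> x \<in> carrier R" using M.a_subset by auto
  define r where "r = c i \<otimes> inv (a i)"
  define c' where "c' = c k \<ominus> r \<otimes> a k"
  \<comment> \<open>The form \<open>c - r a\<close> has coefficient 0 at \<open>i\<close>, the unit
    \<open>c'\<close> at \<open>k\<close>, and prescribed value \<open>t - r s\<close>. This
    determines \<open>\<nu>\<close>, after which the first form determines \<open>\<mu>\<close>.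
    Both lie in \<open>M\<close> because \<open>s\<close> and \<open>t\<close> do.\<close>
  define \<nu> where "\<nu> = inv c' \<otimes> (t \<ominus> r \<otimes> s)"
  define \<mu> where "\<mu> = inv (a i) \<otimes> (s \<ominus> a k \<otimes> \<nu>)"
  have c'U: "c' \<in> Units R" using k by (simp add: c'_def r_def)
  have carr: "a i \<in> carrier R" "a k \<in> carrier R" "c i \<in> carrier R" "c k \<in> carrier R"
     "s \<in> carrier R" "t \<in> carrier R" "inv (a i) \<in> carrier R" "c' \<in> carrier R" "inv c' \<in> carrier R"
    using a c i k st sub c'U by (auto simp: tuples_def)
  have r: "r \<in> carrier R" using carr by (simp add: r_def)
  have nuM: "\<nu> \<in> M" using carr r st by (simp add: \<nu>_def M.I_l_closed minus_eq)
  have muM: "\<mu> \<in> M" using carr r st nuM by (simp add: \<mu>_def M.I_l_closed minus_eq)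
  have mc: "\<mu> \<in> carrier R" "\<nu> \<in> carrier R" using nuM muM sub by auto
  let ?\<delta> = "\<lambda>j s. \<lambda>l\<in>{1..d}. if j = l then s else \<zero>"
  \<comment> \<open>Written as a sum of two one-coordinate tuples, the witness is evaluated by
    additivity, with no case split on whether \<open>i\<close> and \<open>k\<close>
    coincide.\<close>
  let ?x = "vadd d R (?\<delta> i \<mu>) (?\<delta> k \<nu>)"
  have d: "dot d R b ?x = b i \<otimes> \<mu> \<oplus> b k \<otimes> \<nu>" if "b \<in> tuples d R" for b
  proof -
    have "?\<delta> i \<mu> \<in> tuples d R" "?\<delta> k \<nu> \<in> tuples d R" using mc by (auto simp: tuples_def)
    then show ?thesis using that i k mc by (simp add: dot_vadd dot_single)
  qed
  have amu: "a i \<otimes> \<mu> = s \<ominus> a k \<otimes> \<nu>"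
    using i carr mc by (simp add: \<mu>_def m_assoc[symmetric])
  have cnu: "c' \<otimes> \<nu> = t \<ominus> r \<otimes> s"
    using c'U carr r by (simp add: \<nu>_def m_assoc[symmetric])
  have ci: "c i = r \<otimes> a i" using i carr by (simp add: r_def m_assoc)
  have ck: "c k = c' \<oplus> r \<otimes> a k" unfolding c'_def using carr r by algebra
  have "dot d R a ?x = s" unfolding d[OF a] amu using carr mc by algebra
  moreover have "dot d R c ?x = t"
  proof -
    \<comment> \<open>Expressing \<open>c i\<close> and \<open>c k\<close> through \<open>a\<close>
      splits the value into \<open>r\<close> times the first equation plus the reduced equation,
      that is, \<open>r s + (t - r s)\<close>.\<close>
    have "dot d R c ?x = r \<otimes> (a i \<otimes> \<mu>) \<oplus> (c' \<otimes> \<nu> \<oplus> r \<otimes> a k \<otimes> \<nu>)"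
      unfolding d[OF c] ci ck using carr mc r by algebra
    also have "\<dots> = t" unfolding amu cnu using carr mc r by algebra
    finally show ?thesis .
  qed
  moreover have "?x \<in> {1..d} \<rightarrow>\<^sub>E M" using nuM muM by (auto simp: vadd_def)
  ultimately show ?thesis by blast
qed

lemma dot_surj:
  assumes M: "ideal M R" and a: "a \<in> tuples d R"
    and i: "i \<in> {1..d}" "a i \<in> Units R" and s: "s \<in> M"
  shows "\<exists>x \<in> {1..d} \<rightarrow>\<^sub>E M. dot d R a x = s"
proof -
  interpret M: ideal M R by fact
  have sub: "\<And>x. x \<in> M \<Longrightarrow> x \<in> carrier R" using M.a_subset by auto
  let ?x = "\<lambda>l\<in>{1..d}. if i = l then inv (a i) \<otimes> s else \<zero>"
  have "dot d R a ?x = a i \<otimes> (inv (a i) \<otimes> s)"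
    using a i s sub by (intro dot_single) auto
  also have "\<dots> = s"
    using i sub[OF s] m_assoc[of "a i" "inv (a i)" s] by (simp add: Units_closed)
  finally show ?thesis
    using i s by (intro bexI[of _ ?x]) (auto intro!: M.I_l_closed)
qed

text \<open>By \<open>dot_pair_surj\<close> every fibre over \<open>M \<times> M\<close> is
  non-empty, hence as large as the kernel, of size \<open>?N\<close>. The case
  \<open>S = M \<times> M\<close> gives \<open>|M|^d = |M|^2 ?N\<close>, which eliminates
  \<open>?N\<close>. The product form avoids dividing natural numbers.\<close>

lemma card_dot_pair:
  assumes fin: "finite (carrier R)"
    and M: "ideal M R" and a: "a \<in> tuples d R" and c: "c \<in> tuples d R"
    and i: "i \<in> {1..d}" "a i \<in> Units R"
    and k: "k \<in> {1..d}" "c k \<ominus> c i \<otimes> inv (a i) \<otimes> a k \<in> Units R"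
    and S: "S \<subseteq> M \<times> M"
  shows "card {x \<in> {1..d} \<rightarrow>\<^sub>E M. (dot d R a x, dot d R c x) \<in> S} * card M ^ 2 = card S * card M ^ d"
proof -
  interpret M: ideal M R by fact
  have finM: "finite M" using M.a_subset fin finite_subset by blast
  let ?X = "{1..d} \<rightarrow>\<^sub>E M"
  let ?N = "card {x \<in> ?X. (dot d R a x, dot d R c x) = (\<zero>, \<zero>)}"
  have N: "card {x \<in> ?X. (dot d R a x, dot d R c x) = y} = ?N" if "y \<in> M \<times> M" for y
  proof -
    from that obtain x0 where "x0 \<in> ?X" "y = (dot d R a x0, dot d R c x0)"
      using dot_pair_surj[OF M a c i k, of "fst y" "snd y"] by (auto simp: mem_Times_iff)
    then show ?thesis using card_dot_fibre[OF M a c] by simp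
  qed
  have finX: "finite ?X" using finM by (intro finite_PiE) auto
  have main: "card {x \<in> ?X. (dot d R a x, dot d R c x) \<in> S} = card S * ?N" if "S \<subseteq> M \<times> M" for S
    using finX finM finite_cartesian_product[OF finM finM] that N
    by (intro card_vimage_equal_fibres) (blast intro: finite_subset)+
  have "{x \<in> ?X. (dot d R a x, dot d R c x) \<in> M \<times> M} = ?X"
    using dot_in_ideal[OF M] a c by auto
  with main[of "M \<times> M"] have "card ?X = card M ^ 2 * ?N"
    by (simp add: power2_eq_square card_cartesian_product)
  moreover have "card ?X = card M ^ d" by (simp add: card_PiE)
  ultimately show ?thesis using main[OF S] by (simp add: mult.assoc mult.left_commute mult.commute)
qed

lemma card_dot:
  assumes fin: "finite (carrier R)"
    and M: "ideal M R" and a: "a \<in> tuples d R"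
    and i: "i \<in> {1..d}" "a i \<in> Units R" and S: "S \<subseteq> M"
  shows "card {x \<in> {1..d} \<rightarrow>\<^sub>E M. dot d R a x \<in> S} * card M = card S * card M ^ d"
proof -
  interpret M: ideal M R by fact
  have finM: "finite M" using M.a_subset fin finite_subset by blast
  let ?X = "{1..d} \<rightarrow>\<^sub>E M"
  let ?N = "card {x \<in> ?X. dot d R a x = \<zero>}"
  have N: "card {x \<in> ?X. dot d R a x = y} = ?N" if y: "y \<in> M" for y
  proof -
    from y obtain x0 where "x0 \<in> ?X" "y = dot d R a x0"
      using dot_surj[OF M a i y] by auto
    \<comment> \<open>With both forms equal, a fibre of the pair is a fibre of the single
      form.\<close>
    then show ?thesis using card_dot_fibre[OF M a a] by simp
  qed
  have finX: "finite ?X" using finM by (intro finite_PiE) auto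
  have main: "card {x \<in> ?X. dot d R a x \<in> S} = card S * ?N" if "S \<subseteq> M" for S
    using finX finM finite_cartesian_product[OF finM finM] that N
    by (intro card_vimage_equal_fibres) (blast intro: finite_subset)+
  have "{x \<in> ?X. dot d R a x \<in> M} = ?X"
    using dot_in_ideal[OF M a] by auto
  with main[of M] have "card ?X = card M * ?N"
    by simp
  moreover have "card ?X = card M ^ d" by (simp add: card_PiE)
  ultimately show ?thesis using main[OF S] by (simp add: mult.assoc mult.left_commute mult.commute)
qed

end

section \<open>Rings with exactly three ideals\<close>

text \<open>The last two assumptions make the three ideals distinct: \<open>J\<close> lies between
  \<open>{\<zero>}\<close> and \<open>carrier K\<close> and differs from both.\<close>

locale three_ideal_ring = cring K for K (structure) +
  fixes J :: "'a set"
  assumes finite_carrier: "finite (carrier K)"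
    and ideals: "{I. ideal I K} = {{\<zero>}, J, carrier K}"
    and J_nonzero: "J \<noteq> {\<zero>}"
    and J_proper: "J \<noteq> carrier K"
begin

lemma ideal_J: "ideal J K"
  using ideals by blast

sublocale J: ideal J K by (rule ideal_J)

lemma J_carrier: "x \<in> J \<Longrightarrow> x \<in> carrier K"
  using J.a_subset by auto

lemma finite_J: "finite J"
  using J.a_subset finite_carrier finite_subset by blast

lemma J_minus: "x \<in> J \<Longrightarrow> y \<in> J \<Longrightarrow> x \<ominus> y \<in> J"
  by (simp add: minus_eq)

lemma one_notin_J: "\<one> \<notin> J"
  using J.one_imp_carrier J_proper by blast

text \<open>An element outside \<open>J\<close> generates an ideal other than
  \<open>{\<zero>}\<close> and \<open>J\<close>, hence the whole ring; a unit in \<open>J\<close>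
  would put \<open>\<one>\<close> into the proper ideal \<open>J\<close>. So \<open>K\<close> is
  local with maximal ideal \<open>J\<close>.\<close>

lemma Units_eq: "Units K = carrier K - J"
proof -
  have "x \<notin> J" if "x \<in> Units K" for x
  proof
    assume "x \<in> J"
    then have "inv x \<otimes> x \<in> J" using that by (intro J.I_l_closed) auto
    then show False using that one_notin_J by simp
  qed
  moreover have "x \<in> Units K" if "x \<in> carrier K" "x \<notin> J" for x
  proof -
    have "PIdl x \<in> {{\<zero>}, J, carrier K}" using cgenideal_ideal[OF that(1)] ideals by blast
    moreover have "x \<in> PIdl x" using cgenideal_self that by simp
    then have "PIdl x \<noteq> {\<zero>}" "PIdl x \<noteq> J" using that J.zero_closed by auto
    ultimately have "\<one> \<in> PIdl x" using one_closed by blast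
    then obtain y where y: "y \<in> carrier K" "\<one> = y \<otimes> x" by (auto simp: cgenideal_def)
    then have "y \<otimes> x = \<one>" "x \<otimes> y = \<one>" using that m_comm[of x y] by metis+
    then show ?thesis using that y(1) unfolding Units_def by blast
  qed
  ultimately show ?thesis by auto
qed

lemma PIdl_eq_J:
  assumes "w \<in> J - {\<zero>}"
  shows "PIdl w = J"
proof -
  have w: "w \<in> carrier K" using assms J_carrier by auto
  have "PIdl w \<in> {{\<zero>}, J, carrier K}" using cgenideal_ideal[OF w] ideals by blast
  moreover have "w \<in> PIdl w" using cgenideal_self w by simp
  moreover have "PIdl w \<subseteq> J" using assms by (intro cgenideal_minimal[OF ideal_J]) auto
  ultimately show ?thesis using assms J_proper J.a_subset by auto
qed

lemma J_multE:
  assumes "w \<in> J - {\<zero>}" "x \<in> J"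
  obtains y where "y \<in> carrier K" "x = w \<otimes> y"
proof -
  have "x \<in> PIdl w" using PIdl_eq_J assms by simp
  then obtain y where "y \<in> carrier K" "x = y \<otimes> w" by (auto simp: cgenideal_def)
  then show ?thesis using that[of y] assms J_carrier by (simp add: m_comm)
qed

lemma mult_Units_zeroD:
  assumes "u \<in> Units K" "x \<in> carrier K" "x \<otimes> u = \<zero>"
  shows "x = \<zero>"
proof -
  have "x \<otimes> u \<otimes> inv u = x" using assms(1,2) by (simp add: m_assoc Units_closed)
  then show ?thesis using assms by simp
qed

text \<open>A Nakayama-type argument: a nonzero product \<open>x y\<close> would generate
  \<open>J\<close>, so that \<open>x = x y r\<close> for some \<open>r\<close>. As
  \<open>y r\<close> lies in \<open>J\<close>, the factor \<open>1 - y r\<close> is a unit, and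
  \<open>x (1 - y r) = 0\<close> forces \<open>x = 0\<close>.\<close>

lemma J_mult_J:
  assumes "x \<in> J" "y \<in> J"
  shows "x \<otimes> y = \<zero>"
proof (rule ccontr)
  assume nz: "x \<otimes> y \<noteq> \<zero>"
  have c: "x \<in> carrier K" "y \<in> carrier K" using assms J_carrier by auto
  have "x \<otimes> y \<in> J - {\<zero>}" using assms c nz by (simp add: J.I_l_closed)
  then obtain r where r: "r \<in> carrier K" "x = x \<otimes> y \<otimes> r"
    using J_multE assms by metis
  have yr: "y \<otimes> r \<in> J" using assms r by (simp add: J.I_r_closed)
  have "\<one> \<ominus> y \<otimes> r \<notin> J"
  proof
    assume "\<one> \<ominus> y \<otimes> r \<in> J"
    then have "(\<one> \<ominus> y \<otimes> r) \<oplus> y \<otimes> r \<in> J" using yr by simp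
    moreover have "(\<one> \<ominus> y \<otimes> r) \<oplus> y \<otimes> r = \<one>" using c r by algebra
    ultimately show False using one_notin_J by simp
  qed
  then have "\<one> \<ominus> y \<otimes> r \<in> Units K" using c r by (simp add: Units_eq)
  moreover have "x \<otimes> (\<one> \<ominus> y \<otimes> r) = \<zero>"
  proof -
    have "x \<otimes> (\<one> \<ominus> y \<otimes> r) = x \<ominus> x \<otimes> y \<otimes> r" using c r(1) by algebra
    then show ?thesis using r(2) c by (simp add: minus_eq r_neg)
  qed
  ultimately have "x = \<zero>" using mult_Units_zeroD c by blast
  then show False using nz c by simp
qed

text \<open>Units annihilate nothing but zero and products inside \<open>J\<close> vanish, so the
  annihilator of \<open>w\<close> is exactly \<open>J\<close>.\<close>

lemma mult_eq_zero_iff: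
  assumes "w \<in> J - {\<zero>}" "x \<in> carrier K"
  shows "w \<otimes> x = \<zero> \<longleftrightarrow> x \<in> J"
  using assms J_mult_J mult_Units_zeroD[of x w] J_carrier by (auto simp: Units_eq)

lemma Units_mult_J_iff:
  assumes "u \<in> Units K" "x \<in> carrier K"
  shows "u \<otimes> x \<in> J \<longleftrightarrow> x \<in> J"
proof
  assume "u \<otimes> x \<in> J"
  then have "inv u \<otimes> (u \<otimes> x) \<in> J" using assms by (simp add: J.I_l_closed)
  moreover have "inv u \<otimes> (u \<otimes> x) = x"
    using assms m_assoc[of "inv u" u x] by (simp add: Units_closed)
  ultimately show "x \<in> J" by simp
qed (use assms in \<open>auto intro: J.I_l_closed\<close>)

lemma one_plus_J_Units: "h \<in> J \<Longrightarrow> \<one> \<oplus> h \<in> Units K"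
proof -
  assume h: "h \<in> J"
  have "\<one> \<oplus> h \<notin> J"
  proof
    assume "\<one> \<oplus> h \<in> J"
    then have "(\<one> \<oplus> h) \<ominus> h \<in> J" using h by (rule J_minus)
    moreover have "(\<one> \<oplus> h) \<ominus> h = \<one>" using J_carrier[OF h] by algebra
    ultimately show False using one_notin_J by simp
  qed
  then show ?thesis using J_carrier[OF h] by (simp add: Units_eq)
qed

section \<open>Orders of \<open>K\<close>, \<open>K/J\<close> and the unit group\<close>

lemma obtain_J:
  obtains w where "w \<in> J - {\<zero>}"
  using J_nonzero J.zero_closed by blast

text \<open>The solutions form a coset of the annihilator of \<open>w\<close>, which is
  \<open>J\<close>; a solution exists because \<open>w\<close> generates \<open>J\<close>.\<close>

lemma card_mult_fibre:
  assumes w: "w \<in> J - {\<zero>}" and s: "s \<in> J"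
  shows "card {t \<in> carrier K. w \<otimes> t = s} = card J"
proof -
  obtain t0 where t0: "t0 \<in> carrier K" "s = w \<otimes> t0" using J_multE[OF w s] .
  have wc: "w \<in> carrier K" using w J_carrier by auto
  have "bij_betw (\<lambda>h. t0 \<oplus> h) J {t \<in> carrier K. w \<otimes> t = s}"
  proof (rule bij_betw_byWitness[where f' = "\<lambda>t. t \<ominus> t0"])
    show "\<forall>h\<in>J. t0 \<oplus> h \<ominus> t0 = h" using t0 J_carrier by (auto, algebra)
    show "\<forall>t\<in>{t \<in> carrier K. w \<otimes> t = s}. t0 \<oplus> (t \<ominus> t0) = t" using t0 by (auto, algebra)
    show "(\<lambda>h. t0 \<oplus> h) ` J \<subseteq> {t \<in> carrier K. w \<otimes> t = s}"
      using t0 wc J_carrier w by (auto simp: r_distr J_mult_J)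
    show "(\<lambda>t. t \<ominus> t0) ` {t \<in> carrier K. w \<otimes> t = s} \<subseteq> J"
    proof clarify
      fix t assume t: "t \<in> carrier K" "s = w \<otimes> t"
      have "w \<otimes> (t \<ominus> t0) = w \<otimes> t \<ominus> w \<otimes> t0" using t(1) t0(1) wc by algebra
      also have "w \<otimes> t = w \<otimes> t0" using t(2) t0(2) by simp
      also have "w \<otimes> t0 \<ominus> w \<otimes> t0 = \<zero>" using t0(1) wc by (simp add: minus_eq r_neg)
      finally show "t \<ominus> t0 \<in> J" using mult_eq_zero_iff[OF w] t t0 by simp
    qed
  qed
  then show ?thesis by (rule bij_betw_same_card[symmetric])
qed

text \<open>Multiplication by a nonzero \<open>w\<close> in \<open>J\<close> maps \<open>K\<close>
  onto \<open>J\<close> with all fibres of size \<open>|J|\<close>.\<close>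

lemma card_carrier: "card (carrier K) = card J ^ 2"
proof -
  obtain w where w: "w \<in> J - {\<zero>}" by (rule obtain_J)
  have "card {t \<in> carrier K. w \<otimes> t \<in> J} = card J * card J"
    using card_mult_fibre[OF w] finite_carrier finite_J by (intro card_vimage_equal_fibres)
  moreover have "{t \<in> carrier K. w \<otimes> t \<in> J} = carrier K" using w by (auto intro: J.I_r_closed)
  ultimately show ?thesis by (simp add: power2_eq_square)
qed

lemma card_J_gt_1: "card J > 1"
proof -
  obtain w where "w \<in> J - {\<zero>}" by (rule obtain_J)
  then have "card {\<zero>, w} \<le> card J" using finite_J by (intro card_mono) auto
  then show ?thesis using \<open>w \<in> J - {\<zero>}\<close> by (auto simp: One_nat_def)
qed

text \<open>Lagrange's theorem combined with \<open>|K| = |J|^2\<close>. This is what identifies the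
  order \<open>q\<close> of the residue field with \<open>|J|\<close>.\<close>

lemma card_quotient: "card (a_rcosets J) = card J"
proof -
  have "card (a_rcosets J) * card J = card (carrier K)"
    using a_lagrange[OF finite_carrier J.additive_subgroup_axioms] by (simp add: order_def)
  then show ?thesis using card_J_gt_1 card_carrier by (simp add: power2_eq_square)
qed

lemma card_Units: "card (Units K) = card J ^ 2 - card J"
  using card_Diff_subset[OF finite_J J.a_subset] by (simp add: Units_eq card_carrier)

section \<open>Vertices and vertex classes\<close>

lemma unit_tuples_eq: "unit_tuples d K = ({1..d} \<rightarrow>\<^sub>E carrier K) - ({1..d} \<rightarrow>\<^sub>E J)"
  by (simp add: set_eq_iff unit_tuples_def tuples_def Units_eq PiE_iff) blast

lemma unit_tuples_tuples: "a \<in> unit_tuples d K \<Longrightarrow> a \<in> tuples d K"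
  by (simp add: unit_tuples_def)

lemma tuples_mem: "a \<in> tuples d K \<Longrightarrow> i \<in> {1..d} \<Longrightarrow> a i \<in> carrier K"
  by (auto simp: tuples_def)

lemma finite_unit_tuples: "finite (unit_tuples d K)"
  unfolding unit_tuples_eq using finite_carrier by (intro finite_Diff finite_PiE) auto

lemma card_unit_tuples: "card (unit_tuples d K) = (card J ^ 2) ^ d - card J ^ d"
proof -
  have "({1..d} \<rightarrow>\<^sub>E J) \<subseteq> ({1..d} \<rightarrow>\<^sub>E carrier K)"
    using J.a_subset by (intro PiE_mono) auto
  moreover have "finite ({1..d} \<rightarrow>\<^sub>E J)" using finite_J by (intro finite_PiE) auto
  ultimately show ?thesis
    unfolding unit_tuples_eq by (simp add: card_Diff_subset card_PiE card_carrier)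
qed

lemma smul_unit_tuples:
  assumes "u \<in> Units K" "a \<in> unit_tuples d K"
  shows "smul d K u a \<in> unit_tuples d K"
proof -
  obtain i where i: "i \<in> {1..d}" "a i \<in> Units K" using assms by (auto simp: unit_tuples_def)
  then have "smul d K u a i \<in> Units K" using assms by (simp add: smul_def)
  moreover have "smul d K u a \<in> tuples d K"
    using assms by (auto simp: smul_def tuples_def unit_tuples_def intro!: m_closed)
  ultimately show ?thesis using i unfolding unit_tuples_def by blast
qed

lemma smul_smul:
  assumes "u \<in> carrier K" "v \<in> carrier K" "a \<in> tuples d K"
  shows "smul d K u (smul d K v a) = smul d K (u \<otimes> v) a"
  using assms tuples_mem[OF assms(3)] by (auto simp: smul_def fun_eq_iff m_assoc)

lemma smul_one:
  assumes "a \<in> tuples d K"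
  shows "smul d K \<one> a = a"
  using assms tuples_mem[OF assms] by (auto simp: smul_def fun_eq_iff tuples_def PiE_def extensional_def)

lemma unit_multiple_iff:
  "(a, b) \<in> unit_multiple d K \<longleftrightarrow>
    a \<in> unit_tuples d K \<and> b \<in> unit_tuples d K \<and> (\<exists>u \<in> Units K. a = smul d K u b)"
  by (simp add: unit_multiple_def smul_def)

lemma equiv_unit_multiple: "equiv (unit_tuples d K) (unit_multiple d K)"
proof (rule equivI)
  show "unit_multiple d K \<subseteq> unit_tuples d K \<times> unit_tuples d K"
    by (auto simp: unit_multiple_iff)
  show "refl_on (unit_tuples d K) (unit_multiple d K)"
    by (rule refl_onI) (use smul_one unit_tuples_tuples in \<open>force simp: unit_multiple_iff\<close>)
  show "sym (unit_multiple d K)"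
  proof (rule symI)
    fix a b assume "(a, b) \<in> unit_multiple d K"
    then obtain u where u: "a \<in> unit_tuples d K" "b \<in> unit_tuples d K" "u \<in> Units K" "a = smul d K u b"
      by (auto simp: unit_multiple_iff)
    then have "b = smul d K (inv u) a"
      by (simp add: smul_smul smul_one unit_tuples_tuples Units_closed)
    then show "(b, a) \<in> unit_multiple d K" using u by (auto simp: unit_multiple_iff)
  qed
  show "trans (unit_multiple d K)"
  proof (rule transI)
    fix a b c assume "(a, b) \<in> unit_multiple d K" "(b, c) \<in> unit_multiple d K"
    then show "(a, c) \<in> unit_multiple d K"
      by (auto simp: unit_multiple_iff smul_smul unit_tuples_tuples Units_closed)
  qed
qed

lemma tuple_class_eq_iff:
  assumes "a \<in> unit_tuples d K" "b \<in> unit_tuples d K"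
  shows "tuple_class d K a = tuple_class d K b \<longleftrightarrow> (\<exists>u \<in> Units K. a = smul d K u b)"
  using eq_equiv_class_iff[OF equiv_unit_multiple assms] assms
  by (simp add: tuple_class_def unit_multiple_iff)

lemma tuple_class_smul:
  assumes "u \<in> Units K" "a \<in> unit_tuples d K"
  shows "tuple_class d K (smul d K u a) = tuple_class d K a"
  using assms smul_unit_tuples tuple_class_eq_iff by blast

lemma inj_on_smul:
  assumes "a \<in> unit_tuples d K"
  shows "inj_on (\<lambda>u. smul d K u a) (carrier K)"
proof (rule inj_onI)
  fix u v assume uv: "u \<in> carrier K" "v \<in> carrier K" "smul d K u a = smul d K v a"
  obtain i where i: "i \<in> {1..d}" "a i \<in> Units K" using assms by (auto simp: unit_tuples_def)
  have "u \<otimes> a i = v \<otimes> a i" using fun_cong[OF uv(3), of i] i by (simp add: smul_def)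
  then have "a i \<otimes> u = a i \<otimes> v" using uv i by (simp add: m_comm Units_closed)
  then show "u = v" using Units_l_cancel i uv by blast
qed

text \<open>The units act freely on \<open>V'\<close>.\<close>

lemma card_tuple_classes:
  assumes S: "S \<subseteq> unit_tuples d K" and closed: "\<And>u a. u \<in> Units K \<Longrightarrow> a \<in> S \<Longrightarrow> smul d K u a \<in> S"
  shows "card S = card (tuple_class d K ` S) * (card J ^ 2 - card J)"
proof (rule card_image_equal_fibres)
  show "finite S" using S finite_unit_tuples finite_subset by blast
  fix a assume a: "a \<in> S"
  have "{b \<in> S. tuple_class d K b = tuple_class d K a} = (\<lambda>u. smul d K u a) ` Units K"
  proof -
    have "tuple_class d K b = tuple_class d K a \<longleftrightarrow> b \<in> (\<lambda>u. smul d K u a) ` Units K" if "b \<in> S" for b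
      using tuple_class_eq_iff[of b d a] S a that by auto
    then show ?thesis using closed[OF _ a] by blast
  qed
  moreover have "inj_on (\<lambda>u. smul d K u a) (Units K)"
    using S a by (intro inj_on_subset[OF inj_on_smul]) auto
  ultimately show "card {b \<in> S. tuple_class d K b = tuple_class d K a} = card J ^ 2 - card J"
    by (simp add: card_image card_Units)
qed

section \<open>Nearness of tuples: projective points over \<open>K/J\<close>\<close>

text \<open>Two tuples are \<open>near\<close> when they reduce to the same projective point over \<open>K/J\<close>.\<close>

definition near :: "nat \<Rightarrow> ((nat \<Rightarrow> 'a) \<times> (nat \<Rightarrow> 'a)) set" where
  "near d = {(a, b). a \<in> unit_tuples d K \<and> b \<in> unit_tuples d K \<and>
     (\<exists>u \<in> Units K. \<forall>i \<in> {1..d}. b i \<ominus> u \<otimes> a i \<in> J)}"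

lemma equiv_near: "equiv (unit_tuples d K) (near d)"
proof (rule equivI)
  have c: "\<And>a i. a \<in> unit_tuples d K \<Longrightarrow> i \<in> {1..d} \<Longrightarrow> a i \<in> carrier K"
    using unit_tuples_tuples tuples_mem by blast
  show "near d \<subseteq> unit_tuples d K \<times> unit_tuples d K"
    by (auto simp: near_def)
  show "refl_on (unit_tuples d K) (near d)"
    by (rule refl_onI) (use c in \<open>auto simp: near_def minus_eq r_neg intro!: bexI[of _ \<one>]\<close>)
  show "sym (near d)"
  proof (rule symI)
    fix a b assume "(a, b) \<in> near d"
    then obtain u where u: "a \<in> unit_tuples d K" "b \<in> unit_tuples d K" "u \<in> Units K"
      and ub: "\<forall>i \<in> {1..d}. b i \<ominus> u \<otimes> a i \<in> J"
      by (auto simp: near_def)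
    have "a i \<ominus> inv u \<otimes> b i \<in> J" if i: "i \<in> {1..d}" for i
    proof -
      have cc: "a i \<in> carrier K" "b i \<in> carrier K" "u \<in> carrier K" "inv u \<in> carrier K"
        using c u i by auto
      have "(\<ominus> (inv u)) \<otimes> (b i \<ominus> u \<otimes> a i) \<in> J"
        using ub i cc by (intro J.I_l_closed) auto
      moreover have "(\<ominus> (inv u)) \<otimes> (b i \<ominus> u \<otimes> a i) = (inv u \<otimes> u) \<otimes> a i \<ominus> inv u \<otimes> b i"
        using cc by algebra
      ultimately show ?thesis using u cc by simp
    qed
    then show "(b, a) \<in> near d" using u by (auto simp: near_def intro!: bexI[of _ "inv u"])
  qed
  show "trans (near d)"
  proof (rule transI)
    fix a b x assume ab: "(a, b) \<in> near d" and bx: "(b, x) \<in> near d"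
    from ab obtain u where u: "a \<in> unit_tuples d K" "b \<in> unit_tuples d K" "u \<in> Units K"
      and ub: "\<forall>i \<in> {1..d}. b i \<ominus> u \<otimes> a i \<in> J"
      by (auto simp: near_def)
    from bx obtain v where v: "x \<in> unit_tuples d K" "v \<in> Units K"
      and vb: "\<forall>i \<in> {1..d}. x i \<ominus> v \<otimes> b i \<in> J"
      by (auto simp: near_def)
    have "x i \<ominus> v \<otimes> u \<otimes> a i \<in> J" if i: "i \<in> {1..d}" for i
    proof -
      have cc: "a i \<in> carrier K" "b i \<in> carrier K" "x i \<in> carrier K" "u \<in> carrier K" "v \<in> carrier K"
        using c u v i by auto
      have "(x i \<ominus> v \<otimes> b i) \<oplus> v \<otimes> (b i \<ominus> u \<otimes> a i) \<in> J"
        using ub vb i cc by (intro J.a_closed J.I_l_closed) auto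
      moreover have "(x i \<ominus> v \<otimes> b i) \<oplus> v \<otimes> (b i \<ominus> u \<otimes> a i) = x i \<ominus> v \<otimes> u \<otimes> a i"
        using cc by algebra
      ultimately show ?thesis by simp
    qed
    then show "(a, x) \<in> near d" using u v by (auto simp: near_def intro!: bexI[of _ "v \<otimes> u"])
  qed
qed

lemma near_smul:
  assumes "u \<in> Units K" "a \<in> unit_tuples d K"
  shows "(a, smul d K u a) \<in> near d"
proof -
  have "smul d K u a i \<ominus> u \<otimes> a i \<in> J" if "i \<in> {1..d}" for i
    using that assms tuples_mem[OF unit_tuples_tuples[OF assms(2)] that]
    by (simp add: smul_def minus_eq r_neg Units_closed)
  then show ?thesis using assms smul_unit_tuples[OF assms] unfolding near_def by blast
qed

lemma tuple_class_eq_near: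
  assumes "a \<in> unit_tuples d K" "b \<in> unit_tuples d K" "tuple_class d K a = tuple_class d K b"
  shows "(b, a) \<in> near d"
  using assms near_smul by (auto simp: tuple_class_eq_iff)

text \<open>Up to a unit, every tuple near \<open>a\<close> is \<open>a + j\<close> with
  \<open>j\<close> in \<open>J^d\<close>. Two such tuples \<open>a + j\<close> and
  \<open>a + j0\<close> give the same vertex exactly when \<open>j = j0 + h a\<close> for some
  \<open>h\<close> in \<open>J\<close>, and a unit entry of \<open>a\<close> makes \<open>h\<close>
  unique. So the map from \<open>j\<close> to \<open>[a + j]\<close> has fibres of size
  \<open>|J|\<close>.\<close>

lemma card_near_classes:
  assumes a: "a \<in> unit_tuples d K"
  shows "card (tuple_class d K ` (near d `` {a})) * card J = card J ^ d"
proof -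
  let ?X = "{1..d} \<rightarrow>\<^sub>E J"
  let ?f = "\<lambda>j. tuple_class d K (vadd d K a j)"
  obtain i0 where i0: "i0 \<in> {1..d}" "a i0 \<in> Units K" using a by (auto simp: unit_tuples_def)
  have ac: "\<And>i. i \<in> {1..d} \<Longrightarrow> a i \<in> carrier K" using a unit_tuples_tuples tuples_mem by blast
  have jc: "\<And>j i. j \<in> ?X \<Longrightarrow> i \<in> {1..d} \<Longrightarrow> j i \<in> carrier K" using J_carrier by blast
  have aj: "vadd d K a j \<in> unit_tuples d K" if "j \<in> ?X" for j
  proof -
    have "a i0 \<oplus> j i0 \<notin> J"
    proof
      assume "a i0 \<oplus> j i0 \<in> J"
      then have "(a i0 \<oplus> j i0) \<ominus> j i0 \<in> J" using that i0 by (intro J_minus) auto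
      moreover have "(a i0 \<oplus> j i0) \<ominus> j i0 = a i0" using ac jc that i0 by algebra
      ultimately show False using i0 by (simp add: Units_eq)
    qed
    then have "a i0 \<oplus> j i0 \<in> Units K" using ac jc that i0 by (simp add: Units_eq)
    then have "vadd d K a j i0 \<in> Units K" using i0 by (simp add: vadd_def)
    moreover have "vadd d K a j \<in> tuples d K" using ac jc that by (auto simp: vadd_def tuples_def)
    ultimately show ?thesis using i0 by (auto simp: unit_tuples_def)
  qed
  have "tuple_class d K ` (near d `` {a}) = ?f ` ?X"
  proof (intro equalityI subsetI)
    fix x assume "x \<in> tuple_class d K ` (near d `` {a})"
    then obtain b u where b: "x = tuple_class d K b" "b \<in> unit_tuples d K" "u \<in> Units K"
      and ub: "\<forall>i \<in> {1..d}. b i \<ominus> u \<otimes> a i \<in> J"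
      by (auto simp: near_def)
    have bc: "\<And>i. i \<in> {1..d} \<Longrightarrow> b i \<in> carrier K" using b unit_tuples_tuples tuples_mem by blast
    \<comment> \<open>Chosen so that \<open>a + j\<close> is the multiple of \<open>b\<close> by the
      inverse of \<open>u\<close>.\<close>
    define j where "j = (\<lambda>i\<in>{1..d}. inv u \<otimes> (b i \<ominus> u \<otimes> a i))"
    have j: "j \<in> ?X" using ub b by (auto simp: j_def intro!: J.I_l_closed)
    have "vadd d K a j i = smul d K (inv u) b i" for i
    proof (cases "i \<in> {1..d}")
      case True
      then have cc: "a i \<in> carrier K" "b i \<in> carrier K" "u \<in> carrier K" "inv u \<in> carrier K"
        using ac bc b by auto
      have "a i \<oplus> inv u \<otimes> (b i \<ominus> u \<otimes> a i) = a i \<oplus> inv u \<otimes> b i \<ominus> (inv u \<otimes> u) \<otimes> a i"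
        using cc by algebra
      also have "\<dots> = a i \<oplus> inv u \<otimes> b i \<ominus> a i" using b cc by simp
      also have "\<dots> = inv u \<otimes> b i" using cc by algebra
      finally show ?thesis using True by (simp add: vadd_def j_def smul_def)
    qed (auto simp: vadd_def smul_def)
    then have "vadd d K a j = smul d K (inv u) b" by blast
    then have "?f j = x" using b tuple_class_smul[of "inv u" b d] by simp
    then show "x \<in> ?f ` ?X" using j by blast
  next
    fix x assume "x \<in> ?f ` ?X"
    then obtain j where j: "j \<in> ?X" "x = ?f j" by blast
    have "vadd d K a j i \<ominus> \<one> \<otimes> a i \<in> J" if i: "i \<in> {1..d}" for i
    proof -
      have "(a i \<oplus> j i) \<ominus> \<one> \<otimes> a i = j i" using ac[OF i] jc[OF j(1) i] by algebra
      then show ?thesis using i j by (auto simp: vadd_def)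
    qed
    then have "(a, vadd d K a j) \<in> near d" using a aj j by (auto simp: near_def intro!: bexI[of _ \<one>])
    then show "x \<in> tuple_class d K ` (near d `` {a})" using j by blast
  qed
  moreover have "card ?X = card (?f ` ?X) * card J"
  proof (rule card_image_equal_fibres)
    show "finite ?X" using finite_J by (intro finite_PiE) auto
    fix j0 assume j0: "j0 \<in> ?X"
    have mem: "vadd d K j0 (smul d K h a) \<in> ?X" if "h \<in> J" for h
      using that j0 ac by (auto simp: vadd_def smul_def intro!: J.a_closed J.I_r_closed)
    \<comment> \<open>The mixed term \<open>h j0\<close> is zero because products inside
      \<open>J\<close> vanish, so adding \<open>h a\<close> to \<open>j0\<close> scales
      \<open>a + j0\<close> by the unit \<open>1 + h\<close>.\<close>
    have eq: "vadd d K a (vadd d K j0 (smul d K h a)) = smul d K (\<one> \<oplus> h) (vadd d K a j0)"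
      if h: "h \<in> J" for h
    proof
      fix i
      show "vadd d K a (vadd d K j0 (smul d K h a)) i = smul d K (\<one> \<oplus> h) (vadd d K a j0) i"
      proof (cases "i \<in> {1..d}")
        case i: True
        have "(\<one> \<oplus> h) \<otimes> (a i \<oplus> j0 i) = a i \<oplus> (j0 i \<oplus> h \<otimes> a i) \<oplus> h \<otimes> j0 i"
          using ac[OF i] jc[OF j0 i] J_carrier[OF h] by algebra
        also have "h \<otimes> j0 i = \<zero>" using h j0 i by (intro J_mult_J) auto
        finally show ?thesis using i ac[OF i] jc[OF j0 i] J_carrier[OF h]
          by (simp add: vadd_def smul_def)
      qed (auto simp: vadd_def smul_def)
    qed
    have "bij_betw (\<lambda>h. vadd d K j0 (smul d K h a)) J {j \<in> ?X. ?f j = ?f j0}"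
    proof (rule bij_betw_imageI)
      show "inj_on (\<lambda>h. vadd d K j0 (smul d K h a)) J"
      proof (rule inj_onI)
        fix g h assume gh: "g \<in> J" "h \<in> J"
          and e: "vadd d K j0 (smul d K g a) = vadd d K j0 (smul d K h a)"
        have "j0 i0 \<oplus> g \<otimes> a i0 = j0 i0 \<oplus> h \<otimes> a i0"
          using fun_cong[OF e, of i0] i0 by (simp add: vadd_def smul_def)
        then have "a i0 \<otimes> g = a i0 \<otimes> h"
          using gh[THEN J_carrier] ac[OF i0(1)] jc[OF j0 i0(1)] by (simp add: m_comm)
        then show "g = h" using i0 gh J_carrier by (simp add: Units_l_cancel)
      qed
      show "(\<lambda>h. vadd d K j0 (smul d K h a)) ` J = {j \<in> ?X. ?f j = ?f j0}"
      proof (intro equalityI subsetI)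
        fix j assume "j \<in> (\<lambda>h. vadd d K j0 (smul d K h a)) ` J"
        then obtain h where h: "h \<in> J" "j = vadd d K j0 (smul d K h a)" by blast
        then have "?f j = ?f j0"
          using eq[OF h(1)] tuple_class_smul[OF one_plus_J_Units[OF h(1)] aj[OF j0]] by simp
        then show "j \<in> {j \<in> ?X. ?f j = ?f j0}" using mem h by blast
      next
        fix j assume "j \<in> {j \<in> ?X. ?f j = ?f j0}"
        then have j: "j \<in> ?X" "?f j = ?f j0" by auto
        then obtain u where u: "u \<in> Units K" "vadd d K a j = smul d K u (vadd d K a j0)"
          using tuple_class_eq_iff[OF aj[OF j(1)] aj[OF j0]] j(2) by blast
        have ui: "a i \<oplus> j i = u \<otimes> (a i \<oplus> j0 i)" if "i \<in> {1..d}" for i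
          using fun_cong[OF u(2), of i] that by (simp add: vadd_def smul_def)
        have uc: "u \<in> carrier K" using u by auto
        \<comment> \<open>Comparing both tuples modulo \<open>J\<close> at the coordinate
          \<open>i0\<close>, where \<open>a\<close> has a unit entry, forces \<open>u\<close> to be
          1 modulo \<open>J\<close>.\<close>
        have "a i0 \<otimes> (u \<ominus> \<one>) \<in> J"
        proof -
          have cc: "a i0 \<in> carrier K" "j i0 \<in> carrier K" "j0 i0 \<in> carrier K"
            using ac i0 jc j j0 by auto
          have "a i0 \<otimes> (u \<ominus> \<one>) = u \<otimes> (a i0 \<oplus> j0 i0) \<ominus> u \<otimes> j0 i0 \<ominus> a i0"
            using cc uc by algebra
          also have "\<dots> = (a i0 \<oplus> j i0) \<ominus> u \<otimes> j0 i0 \<ominus> a i0" using ui i0 by simp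
          also have "\<dots> = j i0 \<ominus> u \<otimes> j0 i0" using cc uc by algebra
          finally show ?thesis using j j0 i0 uc by (auto intro!: J_minus J.I_l_closed)
        qed
        then have h: "u \<ominus> \<one> \<in> J" using i0 uc by (simp add: Units_mult_J_iff)
        have "j i = vadd d K j0 (smul d K (u \<ominus> \<one>) a) i" for i
        proof (cases "i \<in> {1..d}")
          case i: True
          have cc: "a i \<in> carrier K" "j i \<in> carrier K" "j0 i \<in> carrier K"
            using ac i jc j j0 by auto
          have "j i = (a i \<oplus> j i) \<ominus> a i" using cc by algebra
          also have "\<dots> = u \<otimes> (a i \<oplus> j0 i) \<ominus> a i" using ui i by simp
          also have "\<dots> = j0 i \<oplus> (u \<ominus> \<one>) \<otimes> a i \<oplus> (u \<ominus> \<one>) \<otimes> j0 i" using cc uc by algebra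
          also have "(u \<ominus> \<one>) \<otimes> j0 i = \<zero>" using h j0 i by (intro J_mult_J) auto
          finally show ?thesis using i cc uc by (simp add: vadd_def smul_def)
        qed (use j in \<open>auto simp: vadd_def smul_def PiE_def extensional_def\<close>)
        then show "j \<in> (\<lambda>h. vadd d K j0 (smul d K h a)) ` J" using h by blast
      qed
    qed
    then show "card {j \<in> ?X. ?f j = ?f j0} = card J" by (rule bij_betw_same_card[symmetric])
  qed
  ultimately show ?thesis by (simp add: card_PiE)
qed

section \<open>Counting with the symplectic form\<close>

lemma symplectic_form_in_ideal:
  assumes "ideal M K" "a \<in> tuples (2 * e) K" "x \<in> {1..2*e} \<rightarrow>\<^sub>E M"
  shows "symplectic_form e K a x \<in> M"
proof -
  interpret M: ideal M K by fact
  have "x \<in> tuples (2 * e) K"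
    using assms(3) M.a_subset unfolding tuples_def by (auto simp: PiE_iff)
  moreover have "twist e K x \<in> {1..2*e} \<rightarrow>\<^sub>E M"
    using twist_bij[OF assms(1)] assms(3) by (rule bij_betwE[THEN bspec])
  ultimately show ?thesis
    using assms by (simp add: symplectic_form_eq_dot_twist dot_in_ideal)
qed

text \<open>The count is reindexed along the bijection \<open>twist\<close>. A predicate of two
  values serves the one-form and the two-form counts alike.\<close>

lemma card_symplectic_form_twist:
  assumes M: "ideal M K" and a: "a \<in> tuples (2 * e) K" and c: "c \<in> tuples (2 * e) K"
  shows "card {x \<in> {1..2*e} \<rightarrow>\<^sub>E M. P (symplectic_form e K a x) (symplectic_form e K c x)}
    = card {x \<in> {1..2*e} \<rightarrow>\<^sub>E M. P (dot (2*e) K a x) (dot (2*e) K c x)}"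
proof -
  interpret M: ideal M K by fact
  have t: "x \<in> tuples (2 * e) K" if "x \<in> {1..2*e} \<rightarrow>\<^sub>E M" for x
    using that M.a_subset unfolding tuples_def by (auto simp: PiE_iff)
  show ?thesis
    using a c t
    by (intro bij_betw_same_card[OF bij_betw_Collect[OF twist_bij[OF M]]])
      (simp add: symplectic_form_eq_dot_twist)
qed

lemma card_symplectic_form:
  assumes M: "ideal M K" and a: "a \<in> unit_tuples (2 * e) K"
  shows "card {x \<in> {1..2*e} \<rightarrow>\<^sub>E M. symplectic_form e K a x \<in> S} * card M
    = card (S \<inter> M) * card M ^ (2 * e)"
proof -
  from a obtain i where i: "i \<in> {1..2*e}" "a i \<in> Units K" by (auto simp: unit_tuples_def)
  have at: "a \<in> tuples (2 * e) K" using a by (rule unit_tuples_tuples)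
  \<comment> \<open>On tuples over \<open>M\<close> the form takes values in \<open>M\<close>, so
    \<open>S\<close> can be cut down to a subset of \<open>M\<close>, as \<open>card_dot\<close>
    demands.\<close>
  have "{x \<in> {1..2*e} \<rightarrow>\<^sub>E M. symplectic_form e K a x \<in> S}
     = {x \<in> {1..2*e} \<rightarrow>\<^sub>E M. symplectic_form e K a x \<in> S \<inter> M}"
    using symplectic_form_in_ideal[OF M at] by blast
  then show ?thesis
    using card_symplectic_form_twist[OF M at at, of "\<lambda>s _. s \<in> S \<inter> M"]
      card_dot[OF finite_carrier M at i, of "S \<inter> M"] by simp
qed

text \<open>Linear independence of \<open>a\<close> and \<open>c\<close> modulo \<open>J\<close>, in eliminated form.\<close>

definition indep :: "nat \<Rightarrow> (nat \<Rightarrow> 'a) \<Rightarrow> (nat \<Rightarrow> 'a) \<Rightarrow> bool" where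
  "indep d a c \<longleftrightarrow> (\<exists>i \<in> {1..d}. \<exists>k \<in> {1..d}.
     a i \<in> Units K \<and> c k \<ominus> c i \<otimes> inv (a i) \<otimes> a k \<in> Units K)"

text \<open>Take \<open>i\<close> with \<open>a i\<close> a unit and let \<open>r\<close> be the
  quotient of \<open>c i\<close> by \<open>a i\<close>. Failure of \<open>indep\<close> at this
  \<open>i\<close> says that each eliminated entry is a non-unit, hence lies in
  \<open>J\<close>.\<close>

lemma dependent_imp:
  assumes a: "a \<in> unit_tuples d K" and c: "c \<in> tuples d K" and "\<not> indep d a c"
  obtains r where "r \<in> carrier K" "\<And>k. k \<in> {1..d} \<Longrightarrow> c k \<ominus> r \<otimes> a k \<in> J"
proof -
  from a obtain i where i: "i \<in> {1..d}" "a i \<in> Units K" by (auto simp: unit_tuples_def)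
  have at: "a \<in> tuples d K" using a by (rule unit_tuples_tuples)
  have r: "c i \<otimes> inv (a i) \<in> carrier K" using i tuples_mem[OF c] by auto
  show ?thesis
  proof (rule that[OF r])
    fix k assume k: "k \<in> {1..d}"
    then have "c k \<ominus> c i \<otimes> inv (a i) \<otimes> a k \<in> carrier K"
      using tuples_mem[OF c] tuples_mem[OF at] r by auto
    then show "c k \<ominus> c i \<otimes> inv (a i) \<otimes> a k \<in> J"
      using assms(3) i k by (auto simp: indep_def Units_eq)
  qed
qed

lemma card_symplectic_form_pair:
  assumes M: "ideal M K" and a: "a \<in> tuples (2 * e) K" and c: "c \<in> tuples (2 * e) K"
    and ind: "indep (2 * e) a c"
  shows "card {x \<in> {1..2*e} \<rightarrow>\<^sub>E M. (symplectic_form e K a x, symplectic_form e K c x) \<in> S} * card M ^ 2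
    = card (S \<inter> M \<times> M) * card M ^ (2 * e)"
proof -
  from ind obtain i k where ik: "i \<in> {1..2*e}" "a i \<in> Units K" "k \<in> {1..2*e}"
      "c k \<ominus> c i \<otimes> inv (a i) \<otimes> a k \<in> Units K" by (auto simp: indep_def)
  have "{x \<in> {1..2*e} \<rightarrow>\<^sub>E M. (symplectic_form e K a x, symplectic_form e K c x) \<in> S}
     = {x \<in> {1..2*e} \<rightarrow>\<^sub>E M. (symplectic_form e K a x, symplectic_form e K c x) \<in> S \<inter> M \<times> M}"
    using symplectic_form_in_ideal[OF M a] symplectic_form_in_ideal[OF M c] by blast
  then show ?thesis
    using card_symplectic_form_twist[OF M a c, of "\<lambda>s t. (s, t) \<in> S \<inter> M \<times> M"]
      card_dot_pair[OF finite_carrier M a c ik, of "S \<inter> M \<times> M"] by simp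
qed

text \<open>\<open>V'\<close> is the complement of \<open>J^d\<close> in \<open>K^d\<close>. The
  inequality makes the natural subtraction exact when passing to reals.\<close>

lemma card_unit_tuples_Collect:
  "card {x \<in> unit_tuples d K. P x} =
    card {x \<in> {1..d} \<rightarrow>\<^sub>E carrier K. P x} - card {x \<in> {1..d} \<rightarrow>\<^sub>E J. P x}"
  "card {x \<in> {1..d} \<rightarrow>\<^sub>E J. P x} \<le> card {x \<in> {1..d} \<rightarrow>\<^sub>E carrier K. P x}"
proof -
  have sub: "{x \<in> {1..d} \<rightarrow>\<^sub>E J. P x} \<subseteq> {x \<in> {1..d} \<rightarrow>\<^sub>E carrier K. P x}"
    using PiE_mono[of "{1..d}" "\<lambda>_. J" "\<lambda>_. carrier K"] J.a_subset by blast
  have "finite ({1..d} \<rightarrow>\<^sub>E carrier K)" using finite_carrier by (intro finite_PiE) auto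
  then have fin: "finite {x \<in> {1..d} \<rightarrow>\<^sub>E carrier K. P x}" by simp
  show "card {x \<in> {1..d} \<rightarrow>\<^sub>E J. P x} \<le> card {x \<in> {1..d} \<rightarrow>\<^sub>E carrier K. P x}"
    using card_mono[OF fin sub] .
  have "{x \<in> unit_tuples d K. P x} = {x \<in> {1..d} \<rightarrow>\<^sub>E carrier K. P x} - {x \<in> {1..d} \<rightarrow>\<^sub>E J. P x}"
    by (auto simp: unit_tuples_eq)
  then show "card {x \<in> unit_tuples d K. P x} =
    card {x \<in> {1..d} \<rightarrow>\<^sub>E carrier K. P x} - card {x \<in> {1..d} \<rightarrow>\<^sub>E J. P x}"
    using card_Diff_subset[OF finite_subset[OF sub fin] sub] by simp
qed

text \<open>Since \<open>|K| = q^2\<close> for \<open>q = |J|\<close>, the values in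
  \<open>S\<close> have density \<open>|S \<inter> K| / q^2\<close> among the \<open>q^(4e)\<close>
  tuples over \<open>K\<close> and \<open>|S \<inter> J| / q\<close> among the \<open>q^(2e)\<close>
  tuples over \<open>J\<close>.\<close>

lemma card_unit_tuples_form:
  assumes a: "a \<in> unit_tuples (2 * e) K"
  shows "real (card {x \<in> unit_tuples (2 * e) K. symplectic_form e K a x \<in> S}) =
    real (card (S \<inter> carrier K)) * real (card J) ^ (4 * e) / real (card J) ^ 2
      - real (card (S \<inter> J)) * real (card J) ^ (2 * e) / real (card J)"
proof -
  let ?N = "\<lambda>M. card {x \<in> {1..2*e} \<rightarrow>\<^sub>E M. symplectic_form e K a x \<in> S}"
  have q: "real (card J) > 0" using card_J_gt_1 by simp
  have "real (?N (carrier K)) * real (card J) ^ 2 = real (card (S \<inter> carrier K)) * real (card J) ^ (4 * e)"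
    using card_symplectic_form[OF oneideal a, of S]
    by (simp add: card_carrier power_mult[symmetric] flip: of_nat_power of_nat_mult)
  moreover have "real (?N J) * real (card J) = real (card (S \<inter> J)) * real (card J) ^ (2 * e)"
    using card_symplectic_form[OF ideal_J a, of S] by (simp flip: of_nat_power of_nat_mult)
  ultimately have "real (?N (carrier K)) = real (card (S \<inter> carrier K)) * real (card J) ^ (4 * e) / real (card J) ^ 2"
      "real (?N J) = real (card (S \<inter> J)) * real (card J) ^ (2 * e) / real (card J)"
    using q by (simp_all add: eq_divide_eq)
  then show ?thesis
    using card_unit_tuples_Collect[of "2 * e" "\<lambda>x. symplectic_form e K a x \<in> S"]
    by (simp only: of_nat_diff)
qed

text \<open>As for one form, with densities taken in \<open>K \<times> K\<close> and
  \<open>J \<times> J\<close>, of sizes \<open>q^4\<close> and \<open>q^2\<close>.\<close>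

lemma card_unit_tuples_form_pair:
  assumes a: "a \<in> tuples (2 * e) K" and c: "c \<in> tuples (2 * e) K" and ind: "indep (2 * e) a c"
  shows "real (card {x \<in> unit_tuples (2 * e) K. (symplectic_form e K a x, symplectic_form e K c x) \<in> S}) =
    real (card (S \<inter> carrier K \<times> carrier K)) * real (card J) ^ (4 * e) / real (card J) ^ 4
      - real (card (S \<inter> J \<times> J)) * real (card J) ^ (2 * e) / real (card J) ^ 2"
proof -
  let ?N = "\<lambda>M. card {x \<in> {1..2*e} \<rightarrow>\<^sub>E M. (symplectic_form e K a x, symplectic_form e K c x) \<in> S}"
  have q: "real (card J) > 0" using card_J_gt_1 by simp
  have "real (?N (carrier K)) * real (card J) ^ 4
      = real (card (S \<inter> carrier K \<times> carrier K)) * real (card J) ^ (4 * e)"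
    using card_symplectic_form_pair[OF oneideal a c ind, of S]
    by (simp add: card_carrier power_mult[symmetric] flip: of_nat_power of_nat_mult)
  moreover have "real (?N J) * real (card J) ^ 2 = real (card (S \<inter> J \<times> J)) * real (card J) ^ (2 * e)"
    using card_symplectic_form_pair[OF ideal_J a c ind, of S] by (simp flip: of_nat_power of_nat_mult)
  ultimately have "real (?N (carrier K))
      = real (card (S \<inter> carrier K \<times> carrier K)) * real (card J) ^ (4 * e) / real (card J) ^ 4"
      "real (?N J) = real (card (S \<inter> J \<times> J)) * real (card J) ^ (2 * e) / real (card J) ^ 2"
    using q by (simp_all add: eq_divide_eq)
  then show ?thesis
    using card_unit_tuples_Collect[of "2 * e"
        "\<lambda>x. (symplectic_form e K a x, symplectic_form e K c x) \<in> S"]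
    by (simp only: of_nat_diff)
qed

section \<open>The graph\<close>

text \<open>All representatives of the neighbours of \<open>[a]\<close>. For \<open>a\<close> in
  \<open>V'\<close> this is a union of unit orbits, so its size is \<open>q^2 - q\<close> times the
  number of neighbours.\<close>

definition nbrs :: "nat \<Rightarrow> (nat \<Rightarrow> 'a) \<Rightarrow> (nat \<Rightarrow> 'a) set" where
  "nbrs e a = {x \<in> unit_tuples (2 * e) K. symplectic_form e K a x \<in> J - {\<zero>}}"

lemma Units_mult_J_nonzero_iff:
  assumes "u \<in> Units K" "x \<in> carrier K"
  shows "u \<otimes> x \<in> J - {\<zero>} \<longleftrightarrow> x \<in> J - {\<zero>}"
  using assms Units_mult_J_iff[OF assms] mult_Units_zeroD[OF assms] by (auto simp: m_comm)

lemma symplectic_form_closed: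
  assumes "a \<in> tuples (2 * e) K" "b \<in> tuples (2 * e) K"
  shows "symplectic_form e K a b \<in> carrier K"
  using symplectic_form_in_ideal[OF oneideal] assms by (simp add: tuples_def)

lemma symplectic_form_smul_iff:
  assumes "u \<in> Units K" "v \<in> Units K" "a \<in> unit_tuples (2 * e) K" "b \<in> unit_tuples (2 * e) K"
  shows "symplectic_form e K (smul (2 * e) K u a) (smul (2 * e) K v b) \<in> J - {\<zero>}
    \<longleftrightarrow> symplectic_form e K a b \<in> J - {\<zero>}"
proof -
  have "a \<in> tuples (2 * e) K" "b \<in> tuples (2 * e) K" using assms unit_tuples_tuples by auto
  moreover have "u \<otimes> v \<in> Units K" using assms by simp
  ultimately show ?thesis
    using Units_mult_J_nonzero_iff[of "u \<otimes> v" "symplectic_form e K a b"] assms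
    by (simp add: symplectic_form_smul symplectic_form_closed Units_closed)
qed

lemma smul_nbrs:
  assumes "a \<in> unit_tuples (2 * e) K" "u \<in> Units K" "x \<in> nbrs e a"
  shows "smul (2 * e) K u x \<in> nbrs e a"
proof -
  have x: "x \<in> unit_tuples (2 * e) K" "symplectic_form e K a x \<in> J - {\<zero>}"
    using assms by (simp_all add: nbrs_def)
  show ?thesis
    using symplectic_form_smul_iff[of \<one> u a e x] assms x
    by (simp add: nbrs_def smul_unit_tuples smul_one unit_tuples_tuples)
qed

lemma nbrs_smul:
  assumes "a \<in> unit_tuples (2 * e) K" "u \<in> Units K"
  shows "nbrs e (smul (2 * e) K u a) = nbrs e a"
proof -
  have "symplectic_form e K (smul (2 * e) K u a) x \<in> J - {\<zero>} \<longleftrightarrow> symplectic_form e K a x \<in> J - {\<zero>}"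
    if "x \<in> unit_tuples (2 * e) K" for x
    using symplectic_form_smul_iff[of u \<one> a e x] assms that
    by (simp add: smul_one unit_tuples_tuples)
  then show ?thesis by (auto simp: nbrs_def)
qed

section \<open>Adjacency and neighbourhoods through representatives\<close>

lemma Y_graph_verts: "pverts (Y_graph e K J) = tuple_class (2 * e) K ` unit_tuples (2 * e) K"
  by (auto simp: Y_graph_def quotient_def tuple_class_def)

text \<open>An arc only asserts that some representatives have a form value in
  \<open>J - {\<zero>}\<close>; changing representatives multiplies that value by a unit, so any
  representatives can be tested.\<close>

lemma Y_graph_arc_iff:
  assumes a: "a \<in> unit_tuples (2 * e) K" and b: "b \<in> unit_tuples (2 * e) K"
  shows "(tuple_class (2 * e) K a, tuple_class (2 * e) K b) \<in> parcs (Y_graph e K J)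
    \<longleftrightarrow> symplectic_form e K a b \<in> J - {\<zero>}"
proof
  assume "(tuple_class (2 * e) K a, tuple_class (2 * e) K b) \<in> parcs (Y_graph e K J)"
  then obtain a' b' where ab': "a' \<in> unit_tuples (2 * e) K" "b' \<in> unit_tuples (2 * e) K"
      "symplectic_form e K a' b' \<in> J - {\<zero>}"
    and cl: "tuple_class (2 * e) K a = tuple_class (2 * e) K a'"
      "tuple_class (2 * e) K b = tuple_class (2 * e) K b'"
    by (auto simp: Y_graph_def)
  obtain u v where "u \<in> Units K" "v \<in> Units K" "a = smul (2 * e) K u a'" "b = smul (2 * e) K v b'"
    using cl tuple_class_eq_iff[OF a ab'(1)] tuple_class_eq_iff[OF b ab'(2)] by blast
  then show "symplectic_form e K a b \<in> J - {\<zero>}"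
    using symplectic_form_smul_iff ab' by blast
next
  assume "symplectic_form e K a b \<in> J - {\<zero>}"
  then show "(tuple_class (2 * e) K a, tuple_class (2 * e) K b) \<in> parcs (Y_graph e K J)"
    using a b unfolding Y_graph_def by (simp, blast)
qed

lemma Y_graph_neighbours:
  assumes "a \<in> unit_tuples (2 * e) K"
  shows "neighbours (Y_graph e K J) (tuple_class (2 * e) K a) = tuple_class (2 * e) K ` nbrs e a"
  unfolding neighbours_def Y_graph_verts nbrs_def using Y_graph_arc_iff[OF assms] by blast

text \<open>Taking images need not commute with intersection; here it does because one
  representative of a vertex decides its adjacency to both \<open>[a]\<close> and
  \<open>[b]\<close>.\<close>

lemma Y_graph_common_neighbours:
  assumes a: "a \<in> unit_tuples (2 * e) K" and b: "b \<in> unit_tuples (2 * e) K"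
  shows "neighbours (Y_graph e K J) (tuple_class (2 * e) K a) \<inter>
      neighbours (Y_graph e K J) (tuple_class (2 * e) K b) = tuple_class (2 * e) K ` (nbrs e a \<inter> nbrs e b)"
  unfolding neighbours_def Y_graph_verts nbrs_def
  using Y_graph_arc_iff[OF a] Y_graph_arc_iff[OF b] by blast

lemma Y_graph_pair_graph: "pair_graph (Y_graph e K J)"
proof
  let ?G = "Y_graph e K J"
  have arcs: "parcs ?G \<subseteq> pverts ?G \<times> pverts ?G"
    unfolding Y_graph_verts by (auto simp: Y_graph_def)
  show fin: "finite (pverts ?G)" unfolding Y_graph_verts using finite_unit_tuples by simp
  show "finite (parcs ?G)" using arcs fin finite_subset by blast
  show "fst x \<in> pverts ?G" "snd x \<in> pverts ?G" if "x \<in> parcs ?G" for x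
    using that arcs by auto
  \<comment> \<open>Loops are excluded because the form is alternating.\<close>
  show "fst x \<noteq> snd x" if x: "x \<in> parcs ?G" for x
  proof
    assume eq: "fst x = snd x"
    have "fst x \<in> pverts ?G" using x arcs by auto
    then obtain a where a: "a \<in> unit_tuples (2 * e) K" "fst x = tuple_class (2 * e) K a"
      unfolding Y_graph_verts by blast
    have "x = (tuple_class (2 * e) K a, tuple_class (2 * e) K a)"
      using eq a(2) by (metis prod.collapse)
    then have "symplectic_form e K a a \<in> J - {\<zero>}"
      using x Y_graph_arc_iff[OF a(1) a(1)] by simp
    then show False using symplectic_form_self a(1) unit_tuples_tuples by blast
  qed
  \<comment> \<open>Swapping the arguments negates the form, and \<open>J - {\<zero>}\<close> is
    closed under negation.\<close>
  show "symmetric (with_proj ?G)"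
    unfolding symmetric_def
  proof (rule symI)
    fix x y assume "(x, y) \<in> arcs_ends (with_proj ?G)"
    then have xy: "(x, y) \<in> parcs ?G" by (simp add: arcs_ends_def arc_to_ends_def)
    then have "x \<in> pverts ?G" "y \<in> pverts ?G" using arcs by auto
    then obtain a b where ab: "a \<in> unit_tuples (2 * e) K" "x = tuple_class (2 * e) K a"
        "b \<in> unit_tuples (2 * e) K" "y = tuple_class (2 * e) K b"
      unfolding Y_graph_verts by blast
    have t: "a \<in> tuples (2 * e) K" "b \<in> tuples (2 * e) K" using ab unit_tuples_tuples by auto
    have "symplectic_form e K a b \<in> J - {\<zero>}"
      using xy ab Y_graph_arc_iff[OF ab(1,3)] by simp
    then have "symplectic_form e K b a \<in> J - {\<zero>}"
      using symplectic_form_swap[OF t] symplectic_form_closed[OF t] by auto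
    then have "(y, x) \<in> parcs ?G"
      using ab Y_graph_arc_iff[OF ab(3,1)] by simp
    then show "(y, x) \<in> arcs_ends (with_proj ?G)" by (simp add: arcs_ends_def arc_to_ends_def)
  qed
qed

section \<open>Numbers of vertices, neighbours and common neighbours\<close>

lemma card_J_nonzero: "card (J - {\<zero>}) = card J - 1"
  using finite_J J.zero_closed by (simp add: card_Diff_subset)

lemma card_tuple_classes_real:
  assumes "S \<subseteq> unit_tuples d K" and "\<And>u a. u \<in> Units K \<Longrightarrow> a \<in> S \<Longrightarrow> smul d K u a \<in> S"
  shows "real (card (tuple_class d K ` S)) = real (card S) / (real (card J) * (real (card J) - 1))"
proof -
  have "card J \<le> card J ^ 2" by (simp add: power2_eq_square)
  then have "real (card S) = real (card (tuple_class d K ` S)) * (real (card J) * (real (card J) - 1))"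
    using card_tuple_classes[OF assms] by (simp add: of_nat_diff power2_eq_square algebra_simps)
  then show ?thesis using card_J_gt_1 by simp
qed

lemma card_Y_graph_verts:
  "real (card (pverts (Y_graph e K J))) =
    (real (card J) ^ (4 * e) - real (card J) ^ (2 * e)) / (real (card J) * (real (card J) - 1))"
proof -
  have "card J ^ (2 * e) \<le> (card J ^ 2) ^ (2 * e)"
    using card_J_gt_1 by (simp add: power_mult[symmetric] power_increasing)
  then have "real (card (unit_tuples (2 * e) K)) = real (card J) ^ (4 * e) - real (card J) ^ (2 * e)"
    by (simp add: card_unit_tuples of_nat_diff flip: power_mult)
  then show ?thesis
    unfolding Y_graph_verts using card_tuple_classes_real[OF subset_refl] smul_unit_tuples by simp
qed

lemma card_Y_graph_neighbours:
  assumes a: "a \<in> unit_tuples (2 * e) K"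
  shows "real (card (neighbours (Y_graph e K J) (tuple_class (2 * e) K a))) =
    (real (card J) ^ (4 * e) / real (card J) ^ 2 - real (card J) ^ (2 * e) / real (card J)) / real (card J)"
proof -
  let ?q = "real (card J)"
  have "real (card (nbrs e a)) = (?q - 1) * (?q ^ (4 * e) / ?q ^ 2 - ?q ^ (2 * e) / ?q)"
  proof -
    \<comment> \<open>Both terms of the difference carry the factor \<open>q - 1\<close>, which
      later cancels against the orbit size \<open>q (q - 1)\<close>.\<close>
    have "(J - {\<zero>}) \<inter> carrier K = J - {\<zero>}" "(J - {\<zero>}) \<inter> J = J - {\<zero>}" using J.a_subset by auto
    then show ?thesis
      unfolding nbrs_def card_unit_tuples_form[OF a]
      using card_J_gt_1 by (simp add: card_J_nonzero of_nat_diff One_nat_def right_diff_distrib)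
  qed
  moreover have "real (card (tuple_class (2 * e) K ` nbrs e a)) = real (card (nbrs e a)) / (?q * (?q - 1))"
    using smul_nbrs[OF a] by (intro card_tuple_classes_real) (auto simp: nbrs_def)
  ultimately show ?thesis
    unfolding Y_graph_neighbours[OF a] using card_J_gt_1 by simp
qed

lemma card_Y_graph_common_neighbours:
  assumes a: "a \<in> unit_tuples (2 * e) K" and b: "b \<in> unit_tuples (2 * e) K"
  shows "real (card (neighbours (Y_graph e K J) (tuple_class (2 * e) K a) \<inter>
      neighbours (Y_graph e K J) (tuple_class (2 * e) K b)))
    = real (card (nbrs e a \<inter> nbrs e b)) / (real (card J) * (real (card J) - 1))"
  unfolding Y_graph_common_neighbours[OF a b]
  using smul_nbrs[OF a] smul_nbrs[OF b] by (intro card_tuple_classes_real) (auto simp: nbrs_def)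

lemma card_common_not_near:
  assumes a: "a \<in> unit_tuples (2 * e) K" and b: "b \<in> unit_tuples (2 * e) K" and nn: "(a, b) \<notin> near (2 * e)"
  shows "real (card (nbrs e a \<inter> nbrs e b)) = (real (card J) - 1) ^ 2 *
    (real (card J) ^ (4 * e) / real (card J) ^ 4 - real (card J) ^ (2 * e) / real (card J) ^ 2)"
proof -
  have t: "a \<in> tuples (2 * e) K" "b \<in> tuples (2 * e) K" using a b unit_tuples_tuples by auto
  have ind: "indep (2 * e) a b"
  proof (rule ccontr)
    assume "\<not> indep (2 * e) a b"
    then obtain r where r: "r \<in> carrier K" "\<And>k. k \<in> {1..2*e} \<Longrightarrow> b k \<ominus> r \<otimes> a k \<in> J"
      using dependent_imp[OF a t(2)] by blast
    \<comment> \<open>With \<open>r\<close> in \<open>J\<close> all entries of \<open>b\<close>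
      would lie in \<open>J\<close>, against \<open>b\<close> in \<open>V'\<close>. So
      \<open>r\<close> is a unit, and then \<open>a\<close> and \<open>b\<close> are near.\<close>
    have "r \<notin> J"
    proof
      assume "r \<in> J"
      have "b k \<in> J" if k: "k \<in> {1..2*e}" for k
      proof -
        have cc: "a k \<in> carrier K" "b k \<in> carrier K" using tuples_mem t k by auto
        have "(b k \<ominus> r \<otimes> a k) \<oplus> r \<otimes> a k \<in> J"
          using r(2)[OF k] \<open>r \<in> J\<close> cc by (intro J.a_closed J.I_r_closed)
        moreover have "(b k \<ominus> r \<otimes> a k) \<oplus> r \<otimes> a k = b k" using r(1) cc by algebra
        ultimately show ?thesis by simp
      qed
      then show False using b by (auto simp: unit_tuples_def Units_eq)
    qed
    then have "r \<in> Units K" using r by (simp add: Units_eq)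
    then show False using nn a b r(2) by (auto simp: near_def)
  qed
  let ?S = "(J - {\<zero>}) \<times> (J - {\<zero>})"
  have "nbrs e a \<inter> nbrs e b
      = {x \<in> unit_tuples (2 * e) K. (symplectic_form e K a x, symplectic_form e K b x) \<in> ?S}"
    by (auto simp: nbrs_def)
  \<comment> \<open>All admissible pairs already lie in \<open>J \<times> J\<close>, so both terms
    carry the factor \<open>(q - 1)^2\<close>.\<close>
  moreover have "?S \<inter> carrier K \<times> carrier K = ?S" "?S \<inter> J \<times> J = ?S" using J.a_subset by auto
  moreover have "real (card ?S) = (real (card J) - 1) ^ 2"
    using card_J_gt_1 by (simp add: card_cartesian_product card_J_nonzero of_nat_diff power2_eq_square)
  ultimately show ?thesis
    by (simp only: card_unit_tuples_form_pair[OF t ind]) (simp add: algebra_simps)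
qed

lemma symplectic_form_add_smul:
  assumes "a \<in> tuples (2 * e) K" "c \<in> tuples (2 * e) K" "x \<in> tuples (2 * e) K" "w \<in> carrier K"
  shows "symplectic_form e K (vadd (2 * e) K a (smul (2 * e) K w c)) x
    = symplectic_form e K a x \<oplus> w \<otimes> symplectic_form e K c x"
proof -
  have "twist e K x \<in> tuples (2 * e) K"
    using bij_betwE[OF twist_bij[OF oneideal]] assms(3) unfolding tuples_def by blast
  moreover have wc: "smul (2 * e) K w c \<in> tuples (2 * e) K"
    using assms by (auto simp: smul_def tuples_def)
  moreover have "vadd (2 * e) K a (smul (2 * e) K w c) \<in> tuples (2 * e) K"
    using assms(1) wc unfolding tuples_def by (auto simp: vadd_def intro!: a_closed)
  ultimately show ?thesis
    using assms by (simp add: symplectic_form_eq_dot_twist dot_vadd_left dot_smul_left)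
qed

text \<open>Being dependent modulo \<open>J\<close>, \<open>a\<close> and \<open>b\<close> do not
  fit the pair count. It is applied instead to \<open>a'\<close> and \<open>c\<close> with
  \<open>b = a' + w c\<close>, and to a set \<open>?S\<close> of admissible value pairs inside
  \<open>J \<times> K\<close>.\<close>

lemma card_common_near:
  assumes a: "a \<in> unit_tuples (2 * e) K" and b: "b \<in> unit_tuples (2 * e) K"
    and near: "(a, b) \<in> near (2 * e)" and ne: "tuple_class (2 * e) K a \<noteq> tuple_class (2 * e) K b"
  shows "real (card (nbrs e a \<inter> nbrs e b)) =
    (real (card J) - 1) ^ 2 * real (card J) * real (card J) ^ (4 * e) / real (card J) ^ 4
    - (real (card J) - 1) * real (card J) * real (card J) ^ (2 * e) / real (card J) ^ 2"
proof -
  let ?d = "2 * e"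
  obtain u where u: "u \<in> Units K" and ub: "\<forall>i \<in> {1..?d}. b i \<ominus> u \<otimes> a i \<in> J"
    using near by (auto simp: near_def)
  define a' where "a' = smul ?d K u a"
  have a': "a' \<in> unit_tuples ?d K" using a u smul_unit_tuples by (simp add: a'_def)
  have nb: "nbrs e a' = nbrs e a" using nbrs_smul a u by (simp add: a'_def)
  have ne': "tuple_class ?d K b \<noteq> tuple_class ?d K a'"
    using ne tuple_class_smul a u by (simp add: a'_def)
  have ba: "\<forall>i \<in> {1..?d}. b i \<ominus> a' i \<in> J" using ub by (simp add: a'_def smul_def)
  have t: "a' \<in> tuples ?d K" "b \<in> tuples ?d K" using a' b unit_tuples_tuples by auto
  obtain w where w: "w \<in> J - {\<zero>}" by (rule obtain_J)
  have wc: "w \<in> carrier K" using w J_carrier by auto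
  \<comment> \<open>Each entry of \<open>b - a'\<close> lies in \<open>J\<close>, hence is a
    multiple of the generator \<open>w\<close>; the cofactors form the tuple
    \<open>c\<close>.\<close>
  have "\<forall>i \<in> {1..?d}. \<exists>y \<in> carrier K. b i \<ominus> a' i = w \<otimes> y"
    using ba J_multE[OF w] by metis
  then obtain f where f: "\<And>i. i \<in> {1..?d} \<Longrightarrow> f i \<in> carrier K \<and> b i \<ominus> a' i = w \<otimes> f i" by metis
  define c where "c = restrict f {1..?d}"
  have ct: "c \<in> tuples ?d K" using f by (auto simp: c_def tuples_def)
  have ci: "b i = a' i \<oplus> w \<otimes> c i" if i: "i \<in> {1..?d}" for i
  proof -
    have "b i = a' i \<oplus> (b i \<ominus> a' i)" using tuples_mem[OF t(1) i] tuples_mem[OF t(2) i] by algebra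
    then show ?thesis using f[OF i] i by (simp add: c_def)
  qed
  have bc: "b = vadd ?d K a' (smul ?d K w c)"
  proof
    fix i show "b i = vadd ?d K a' (smul ?d K w c) i"
      using ci[of i] t(2) by (cases "i \<in> {1..?d}") (auto simp: vadd_def smul_def tuples_def PiE_def extensional_def)
  qed
  have ind: "indep ?d a' c"
  proof (rule ccontr)
    assume "\<not> indep ?d a' c"
    then obtain r where r: "r \<in> carrier K" "\<And>k. k \<in> {1..?d} \<Longrightarrow> c k \<ominus> r \<otimes> a' k \<in> J"
      using dependent_imp[OF a' ct] by blast
    have "b i = smul ?d K (\<one> \<oplus> w \<otimes> r) a' i" for i
    proof (cases "i \<in> {1..?d}")
      case i: True
      have cc: "a' i \<in> carrier K" "c i \<in> carrier K" using tuples_mem[OF t(1) i] tuples_mem[OF ct i] by auto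
      \<comment> \<open>As \<open>w\<close> annihilates \<open>J\<close>, the tuple
        \<open>w c\<close> equals \<open>w r a'\<close>. Then \<open>b = (1 + w r) a'\<close> would
        represent the same vertex as \<open>a'\<close>.\<close>
      have "w \<otimes> (c i \<ominus> r \<otimes> a' i) = \<zero>" using w r(2)[OF i] by (intro J_mult_J) auto
      moreover have "a' i \<oplus> w \<otimes> c i = (\<one> \<oplus> w \<otimes> r) \<otimes> a' i \<oplus> w \<otimes> (c i \<ominus> r \<otimes> a' i)"
        using cc wc r(1) by algebra
      ultimately show ?thesis using ci[OF i] i cc wc r(1) by (simp add: smul_def)
    qed (use t(2) in \<open>auto simp: smul_def tuples_def PiE_def extensional_def\<close>)
    then have "b = smul ?d K (\<one> \<oplus> w \<otimes> r) a'" by blast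
    moreover have "\<one> \<oplus> w \<otimes> r \<in> Units K" using w r(1) by (intro one_plus_J_Units J.I_r_closed) auto
    ultimately show False using ne' tuple_class_smul[OF _ a'] by metis
  qed
  let ?T = "\<lambda>s. {t \<in> carrier K. s \<oplus> w \<otimes> t \<noteq> \<zero>}"
  let ?S = "SIGMA s:J - {\<zero>}. ?T s"
  have "nbrs e a \<inter> nbrs e b
      = {x \<in> unit_tuples ?d K. (symplectic_form e K a' x, symplectic_form e K c x) \<in> ?S}"
  proof -
    \<comment> \<open>The term \<open>w <c, x>\<close> always lies in \<open>J\<close>, so once
      \<open><a', x>\<close> does, \<open><b, x>\<close> lies in \<open>J\<close> automatically and
      only its nonvanishing remains to be required.\<close>
    have "symplectic_form e K b x \<in> J - {\<zero>} \<longleftrightarrow> symplectic_form e K c x \<in> ?T (symplectic_form e K a' x)"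
      if "x \<in> unit_tuples ?d K" "symplectic_form e K a' x \<in> J - {\<zero>}" for x
    proof -
      have x: "x \<in> tuples ?d K" using that unit_tuples_tuples by simp
      have fc: "symplectic_form e K c x \<in> carrier K" using symplectic_form_closed ct x by simp
      have "symplectic_form e K b x = symplectic_form e K a' x \<oplus> w \<otimes> symplectic_form e K c x"
        unfolding bc using symplectic_form_add_smul[OF t(1) ct x wc] .
      moreover have "w \<otimes> symplectic_form e K c x \<in> J" using w fc by (intro J.I_r_closed) auto
      ultimately show ?thesis using that fc by simp
    qed
    then show ?thesis unfolding nb[symmetric] by (auto simp: nbrs_def)
  qed
  moreover have "?S \<inter> carrier K \<times> carrier K = ?S" using J.a_subset by auto
  moreover have "?S \<inter> J \<times> J = (J - {\<zero>}) \<times> J"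
  proof -
    \<comment> \<open>For \<open>t\<close> in \<open>J\<close> the term \<open>w t\<close> vanishes,
      so all \<open>q\<close> values of \<open>t\<close> are admissible in the subtracted
      count.\<close>
    have "t \<in> ?T s" if "s \<in> J - {\<zero>}" "t \<in> J" for s t
      using J_mult_J[of w t] w that J_carrier by simp
    then show ?thesis by blast
  qed
  moreover have "real (card ?S) = (real (card J) - 1) * (real (card J) ^ 2 - real (card J))"
  proof -
    have "card (?T s) = card J ^ 2 - card J" if s: "s \<in> J" for s
    proof -
      \<comment> \<open>The excluded \<open>t\<close> form one fibre of multiplication by
        \<open>w\<close>, which has \<open>q\<close> of the \<open>q^2\<close> elements of
        \<open>K\<close>.\<close>
      have "s \<oplus> w \<otimes> t = \<zero> \<longleftrightarrow> w \<otimes> t = \<ominus> s" if "t \<in> carrier K" for t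
        using J_carrier[OF s] wc that
        by (metis a_comm m_closed minus_equality r_neg a_inv_closed)
      then have "?T s = carrier K - {t \<in> carrier K. w \<otimes> t = \<ominus> s}" by auto
      moreover have "card {t \<in> carrier K. w \<otimes> t = \<ominus> s} = card J"
        using card_mult_fibre[OF w] s by simp
      ultimately show ?thesis
        using finite_carrier by (simp add: card_Diff_subset card_carrier)
    qed
    then have "card ?S = (card J - 1) * (card J ^ 2 - card J)"
      using finite_J finite_carrier by (simp add: card_SigmaI card_J_nonzero)
    moreover have "card J \<le> card J ^ 2" by (simp add: power2_eq_square)
    ultimately show ?thesis using card_J_gt_1 by (simp add: of_nat_diff)
  qed
  moreover have "real (card ((J - {\<zero>}) \<times> J)) = (real (card J) - 1) * real (card J)"
    using card_J_gt_1 by (simp add: card_cartesian_product card_J_nonzero of_nat_diff)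
  ultimately show ?thesis
    by (simp only: card_unit_tuples_form_pair[OF t(1) ct ind]) (simp add: power2_eq_square algebra_simps)
qed

section \<open>The partition of the vertices\<close>

definition vertex_classes :: "nat \<Rightarrow> (nat \<Rightarrow> 'a) set set set" where
  "vertex_classes d = (\<lambda>C. tuple_class d K ` C) ` (unit_tuples d K // near d)"

lemma vertex_classesE:
  assumes "C \<in> vertex_classes d"
  obtains a where "a \<in> unit_tuples d K" "C = tuple_class d K ` (near d `` {a})"
  using assms by (auto simp: vertex_classes_def elim: quotientE)

text \<open>Nearness is coarser than proportionality by units, so its classes of tuples descend to a
  partition of the vertices.\<close>

lemma partition_vertex_classes:
  "partition_on (tuple_class d K ` unit_tuples d K) (vertex_classes d)"
proof (rule partition_onI)
  show "\<Union> (vertex_classes d) = tuple_class d K ` unit_tuples d K"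
    unfolding vertex_classes_def using Union_quotient[OF equiv_near[of d]] by (simp flip: image_Union)
  show "{} \<notin> vertex_classes d"
    unfolding vertex_classes_def using in_quotient_imp_non_empty[OF equiv_near[of d]] by force
  fix C D assume CD: "C \<in> vertex_classes d" "D \<in> vertex_classes d" "C \<noteq> D"
  obtain a where a: "a \<in> unit_tuples d K" "C = tuple_class d K ` (near d `` {a})"
    using vertex_classesE CD(1) .
  obtain b where b: "b \<in> unit_tuples d K" "D = tuple_class d K ` (near d `` {b})"
    using vertex_classesE CD(2) .
  have tr: "trans (near d)" and sy: "sym (near d)" using equiv_near by (auto elim: equivE)
  show "disjnt C D"
    unfolding disjnt_def
  proof (rule equals0I)
    fix x assume "x \<in> C \<inter> D"
    then obtain x1 x2 where x: "(a, x1) \<in> near d" "(b, x2) \<in> near d"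
        "tuple_class d K x1 = tuple_class d K x2"
      using a b by auto
    \<comment> \<open>Equal vertices have near representatives, so the chain \<open>a\<close>,
      \<open>x1\<close>, \<open>x2\<close>, \<open>b\<close> joins the two classes.\<close>
    moreover from x have "(x2, x1) \<in> near d"
      by (intro tuple_class_eq_near) (auto simp: near_def)
    ultimately have "(a, b) \<in> near d" using tr sy by (meson symD transD)
    then have "near d `` {a} = near d `` {b}" using equiv_class_eq[OF equiv_near] by blast
    then show False using a b CD by simp
  qed
qed

end

section \<open>Assembling the parameters of the design\<close>

lemma (in three_ideal_ring) Y_graph_divisible_design_graph:
  assumes e: "e \<ge> 2" and q: "q = card J"
  shows "\<exists>v k l1 l2 m n :: nat.
    divisible_design_graph (Y_graph e K J) v k l1 l2 m n \<and>
    real v = real q ^ (2 * e - 1) * (real q ^ (2 * e) - 1) / (real q - 1) \<and>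
    real k = real q ^ (4 * e - 3) - real q ^ (2 * e - 2) \<and>
    real l1 = real q ^ (4 * e - 3) - real q ^ (4 * e - 4) - real q ^ (2 * e - 2) \<and>
    real l2 = real q ^ (4 * e - 4) - real q ^ (4 * e - 5) - real q ^ (2 * e - 2) + real q ^ (2 * e - 3) \<and>
    real m = (real q ^ (2 * e) - 1) / (real q - 1) \<and>
    real n = real q ^ (2 * e - 1)"
proof -
  let ?G = "Y_graph e K J" and ?d = "2 * e"
  let ?cl = "tuple_class ?d K" and ?U = "unit_tuples ?d K" and ?P = "vertex_classes ?d"
  define Q where "Q = real q"
  have Q1: "Q > 1" and Q0: "Q > 0" "Q \<noteq> 0" "Q - 1 \<noteq> 0" using card_J_gt_1 by (auto simp: Q_def q)
  have QJ: "real (card J) = Q" by (simp add: Q_def q)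
  \<comment> \<open>With \<open>e = f + 2\<close> and \<open>X = Q^(2f)\<close> every power in sight
    becomes a monomial in \<open>X\<close> and \<open>Q\<close>, free of truncated exponents; the
    remaining identities are polynomial.\<close>
  obtain f where f: "e = f + 2" using e by (metis le_add_diff_inverse2)
  define X where "X = Q ^ (2 * f)"
  have pw: "Q ^ (4 * e) = X ^ 2 * Q ^ 8" "Q ^ (2 * e) = X * Q ^ 4" "Q ^ (4 * e - 3) = X ^ 2 * Q ^ 5"
    "Q ^ (2 * e - 2) = X * Q ^ 2" "Q ^ (4 * e - 4) = X ^ 2 * Q ^ 4" "Q ^ (4 * e - 5) = X ^ 2 * Q ^ 3"
    "Q ^ (2 * e - 3) = X * Q" "Q ^ (2 * e - 1) = X * Q ^ 3"
  proof -
    have "4 * e = 2 * f * 2 + 8" "2 * e = 2 * f + 4" "4 * e - 3 = 2 * f * 2 + 5" "2 * e - 2 = 2 * f + 2"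
      "4 * e - 4 = 2 * f * 2 + 4" "4 * e - 5 = 2 * f * 2 + 3" "2 * e - 3 = 2 * f + 1" "2 * e - 1 = 2 * f + 3"
      unfolding f by simp_all
    then show "Q ^ (4 * e) = X ^ 2 * Q ^ 8" "Q ^ (2 * e) = X * Q ^ 4" "Q ^ (4 * e - 3) = X ^ 2 * Q ^ 5"
      "Q ^ (2 * e - 2) = X * Q ^ 2" "Q ^ (4 * e - 4) = X ^ 2 * Q ^ 4" "Q ^ (4 * e - 5) = X ^ 2 * Q ^ 3"
      "Q ^ (2 * e - 3) = X * Q" "Q ^ (2 * e - 1) = X * Q ^ 3"
      unfolding X_def by (simp_all only: power_add power_mult power_one_right)
  qed
  \<comment> \<open>The forms of \<open>k\<close>, \<open>l1\<close> and \<open>l2\<close> are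
    chosen so that no natural subtraction truncates; for \<open>l2\<close> this is achieved by
    factoring out \<open>q - 1\<close>.\<close>
  define v k l1 l2 m n where "v = card (pverts ?G)" and "k = q ^ (4 * e - 3) - q ^ (2 * e - 2)"
    and "l1 = q ^ (4 * e - 3) - (q ^ (4 * e - 4) + q ^ (2 * e - 2))"
    and "l2 = (q - 1) * (q ^ (4 * e - 5) - q ^ (2 * e - 3))"
    and "m = card ?P" and "n = q ^ (2 * e - 1)"
  have q2: "q \<ge> 2" using card_J_gt_1 q by simp
  have v: "real v = X * Q ^ 3 * (X * Q ^ 4 - 1) / (Q - 1)"
  proof -
    have "X ^ 2 * Q ^ 8 - X * Q ^ 4 = Q * (X * Q ^ 3 * (X * Q ^ 4 - 1))" by Groebner_Basis.algebra
    then show ?thesis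
      using card_Y_graph_verts[of e] Q0 unfolding v_def QJ pw by simp
  qed
  have k: "real k = X ^ 2 * Q ^ 5 - X * Q ^ 2"
  proof -
    have "q ^ (2 * e - 2) \<le> q ^ (4 * e - 3)" using q2 e by (intro power_increasing) auto
    then have "real k = Q ^ (4 * e - 3) - Q ^ (2 * e - 2)" by (simp add: k_def of_nat_diff Q_def)
    then show ?thesis by (simp add: pw)
  qed
  have l1: "real l1 = X ^ 2 * Q ^ 5 - X ^ 2 * Q ^ 4 - X * Q ^ 2"
  proof -
    have "q ^ (2 * e - 2) \<le> q ^ (4 * e - 4)" using q2 e by (intro power_increasing) auto
    \<comment> \<open>Each subtracted power is at most \<open>q^(4e-4)\<close> and
      \<open>2 \<le> q\<close>, so their sum is at most \<open>q^(4e-3)\<close>.\<close>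
    then have "q ^ (4 * e - 4) + q ^ (2 * e - 2) \<le> 2 * q ^ (4 * e - 4)" by simp
    also have "\<dots> \<le> q * q ^ (4 * e - 4)" using q2 by (intro mult_right_mono) auto
    also have "\<dots> = q ^ Suc (4 * e - 4)" by simp
    also have "Suc (4 * e - 4) = 4 * e - 3" using e by simp
    finally have "real l1 = Q ^ (4 * e - 3) - (Q ^ (4 * e - 4) + Q ^ (2 * e - 2))"
      by (simp add: l1_def of_nat_diff Q_def)
    then show ?thesis by (simp add: pw)
  qed
  have l2: "real l2 = (Q - 1) * (X ^ 2 * Q ^ 3 - X * Q)"
  proof -
    have "q ^ (2 * e - 3) \<le> q ^ (4 * e - 5)" using q2 e by (intro power_increasing) auto
    then have "real l2 = (Q - 1) * (Q ^ (4 * e - 5) - Q ^ (2 * e - 3))"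
      using q2 by (simp add: l2_def of_nat_diff Q_def)
    then show ?thesis by (simp add: pw)
  qed
  have n: "real n = X * Q ^ 3" by (simp add: n_def flip: pw Q_def)
  have part: "partition_on (pverts ?G) ?P"
    using partition_vertex_classes[of ?d] by (simp add: Y_graph_verts)
  have size: "card C = n" if "C \<in> ?P" for C
  proof -
    obtain a where a: "a \<in> ?U" "C = ?cl ` (near ?d `` {a})" using vertex_classesE \<open>C \<in> ?P\<close> .
    \<comment> \<open>Writing the exponent \<open>2e\<close> as a successor lets one factor
      \<open>q\<close> cancel.\<close>
    have "card C * q = q ^ Suc (2 * e - 1)"
      using card_near_classes[OF a(1)] e by (simp add: a(2) q)
    then show ?thesis using q2 by (simp add: n_def)
  qed
  \<comment> \<open>The number of classes is not counted directly: it follows from \<open>v\<close>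
    and the common class size.\<close>
  have vmn: "v = m * n"
  proof -
    have fin: "finite (pverts ?G)" using finite_unit_tuples by (simp add: Y_graph_verts)
    have "card (\<Union> ?P) = (\<Sum>C\<in>?P. card C)"
      using part fin
      by (intro card_Union_disjoint)
        (auto simp: partition_on_def disjoint_def pairwise_def disjnt_def intro: finite_subset)
    then show ?thesis using part size by (simp add: v_def m_def partition_on_def)
  qed
  have m: "real m = (X * Q ^ 4 - 1) / (Q - 1)"
  proof -
    have "real m * (X * Q ^ 3) = (X * Q ^ 4 - 1) / (Q - 1) * (X * Q ^ 3)"
      using v n vmn by (simp add: mult.commute)
    moreover have "X * Q ^ 3 \<noteq> 0" using Q0 by (simp add: X_def)
    ultimately show ?thesis by (metis mult_right_cancel)
  qed
  have deg: "card (neighbours ?G x) = k" if x: "x \<in> pverts ?G" for x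
  proof -
    obtain a where a: "a \<in> ?U" "x = ?cl a" using x unfolding Y_graph_verts by blast
    have "X ^ 2 * Q ^ 8 / Q ^ 2 = X ^ 2 * Q ^ 6" "X * Q ^ 4 / Q = X * Q ^ 3"
      by ((subst nonzero_divide_eq_eq, use Q0 in simp, Groebner_Basis.algebra)+)
    \<comment> \<open>The factor \<open>q - 1\<close> is already cancelled in
      \<open>card_Y_graph_neighbours\<close>; only the division by \<open>q\<close> is left.\<close>
    moreover have "X ^ 2 * Q ^ 6 - X * Q ^ 3 = Q * (X ^ 2 * Q ^ 5 - X * Q ^ 2)" by Groebner_Basis.algebra
    ultimately have "real (card (neighbours ?G x)) = real k"
      using card_Y_graph_neighbours[OF a(1)] Q0 unfolding a(2) k QJ pw by simp
    then show ?thesis by simp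
  qed
  have same: "card (neighbours ?G x \<inter> neighbours ?G y) = l1"
    if C: "C \<in> ?P" and xy: "x \<in> C" "y \<in> C" "x \<noteq> y" for C x y
  proof -
    obtain c where c: "c \<in> ?U" "C = ?cl ` (near ?d `` {c})" using vertex_classesE C .
    then obtain a b where ab: "x = ?cl a" "y = ?cl b" "(c, a) \<in> near ?d" "(c, b) \<in> near ?d" using xy by auto
    then have nab: "(a, b) \<in> near ?d" using equiv_near[of ?d] by (meson equivE symD transD)
    have U: "a \<in> ?U" "b \<in> ?U" using nab by (auto simp: near_def)
    have "(Q - 1) ^ 2 * Q * (X ^ 2 * Q ^ 8) / Q ^ 4 = (Q - 1) ^ 2 * X ^ 2 * Q ^ 5"
        "(Q - 1) * Q * (X * Q ^ 4) / Q ^ 2 = (Q - 1) * X * Q ^ 3"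
      by ((subst nonzero_divide_eq_eq, use Q0 in simp, Groebner_Basis.algebra)+)
    then have "real (card (nbrs e a \<inter> nbrs e b)) = (Q - 1) ^ 2 * X ^ 2 * Q ^ 5 - (Q - 1) * X * Q ^ 3"
      using card_common_near[OF U nab] xy(3) unfolding ab QJ pw by simp
    \<comment> \<open>The factor \<open>Q * (Q - 1)\<close> is the number of representatives per
      vertex, and the cofactor is \<open>l1\<close>.\<close>
    also have "\<dots> = (X ^ 2 * Q ^ 5 - X ^ 2 * Q ^ 4 - X * Q ^ 2) * (Q * (Q - 1))" by Groebner_Basis.algebra
    finally have "real (card (neighbours ?G x \<inter> neighbours ?G y)) = real l1"
      using card_Y_graph_common_neighbours[OF U] Q0 unfolding ab l1 QJ by simp
    then show ?thesis by simp
  qed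
  have diff: "card (neighbours ?G x \<inter> neighbours ?G y) = l2"
    if CD: "C \<in> ?P" "D \<in> ?P" "C \<noteq> D" and xy: "x \<in> C" "y \<in> D" for C D x y
  proof -
    obtain c where c: "c \<in> ?U" "C = ?cl ` (near ?d `` {c})" using vertex_classesE CD(1) .
    obtain c' where c': "c' \<in> ?U" "D = ?cl ` (near ?d `` {c'})" using vertex_classesE CD(2) .
    obtain a b where ab: "x = ?cl a" "y = ?cl b" "(c, a) \<in> near ?d" "(c', b) \<in> near ?d"
      using c c' xy by auto
    have U: "a \<in> ?U" "b \<in> ?U" using ab by (auto simp: near_def)
    have nab: "(a, b) \<notin> near ?d"
    proof
      assume "(a, b) \<in> near ?d"
      then have "(c, c') \<in> near ?d" using ab equiv_near[of ?d] by (meson equivE symD transD)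
      then have "near ?d `` {c} = near ?d `` {c'}" using equiv_class_eq[OF equiv_near] by blast
      then show False using c c' CD by simp
    qed
    have "X ^ 2 * Q ^ 8 / Q ^ 4 = X ^ 2 * Q ^ 4" "X * Q ^ 4 / Q ^ 2 = X * Q ^ 2"
      by ((subst nonzero_divide_eq_eq, use Q0 in simp, Groebner_Basis.algebra)+)
    then have "real (card (nbrs e a \<inter> nbrs e b)) = (Q - 1) ^ 2 * (X ^ 2 * Q ^ 4 - X * Q ^ 2)"
      using card_common_not_near[OF U nab] unfolding QJ pw by simp
    also have "\<dots> = (Q - 1) * (X ^ 2 * Q ^ 3 - X * Q) * (Q * (Q - 1))" by Groebner_Basis.algebra
    finally have "real (card (neighbours ?G x \<inter> neighbours ?G y)) = real l2"
      using card_Y_graph_common_neighbours[OF U] Q0 unfolding ab l2 QJ by simp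
    then show ?thesis by simp
  qed
  have "divisible_design_graph ?G v k l1 l2 m n"
    unfolding divisible_design_graph_def
  proof (intro conjI exI[of _ ?P] ballI impI)
    show "card (pverts ?G) = v" "card ?P = m" by (simp_all only: v_def m_def)
    show "card (neighbours ?G x) = k" if "x \<in> pverts ?G" for x by (rule deg[OF that])
    show "card C = n" if "C \<in> ?P" for C by (rule size[OF that])
    show "card (neighbours ?G x \<inter> neighbours ?G y) = l1"
      if "C \<in> ?P" "x \<in> C" "y \<in> C" "x \<noteq> y" for C x y by (rule same[OF that])
    show "card (neighbours ?G x \<inter> neighbours ?G y) = l2"
      if "C \<in> ?P" "D \<in> ?P" "C \<noteq> D" "x \<in> C" "y \<in> D" for C D x y by (rule diff[OF that])
  qed (fact Y_graph_pair_graph part)+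
  moreover have "real l2 = X ^ 2 * Q ^ 4 - X ^ 2 * Q ^ 3 - X * Q ^ 2 + X * Q"
    unfolding l2 by Groebner_Basis.algebra
  ultimately show ?thesis
    using v k l1 m n unfolding Q_def[symmetric] pw
    by (intro exI[of _ v] exI[of _ k] exI[of _ l1] exI[of _ l2] exI[of _ m] exI[of _ n] conjI)
qed

theorem theorem1p2:
  fixes e q :: nat
    and K :: "('a, 'c) ring_scheme"
    and J :: "'a set"
    and F :: "('b, 'd) ring_scheme"
  assumes "e \<ge> 2"
    and "cring K" and "finite (carrier K)"
    and "{I. ideal I K} = {{\<zero>\<^bsub>K\<^esub>}, J, carrier K}"
    and "card {I. ideal I K} = 3"
    and "field F" and "finite (carrier F)" and "card (carrier F) = q"
    and "primepow q"
    and "K Quot J \<simeq> F"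
  shows "\<exists>v k l1 l2 m n :: nat.
    divisible_design_graph (Y_graph e K J) v k l1 l2 m n \<and>
    real v = real q ^ (2 * e - 1) * (real q ^ (2 * e) - 1) / (real q - 1) \<and>
    real k = real q ^ (4 * e - 3) - real q ^ (2 * e - 2) \<and>
    real l1 = real q ^ (4 * e - 3) - real q ^ (4 * e - 4) - real q ^ (2 * e - 2) \<and>
    real l2 = real q ^ (4 * e - 4) - real q ^ (4 * e - 5) - real q ^ (2 * e - 2) + real q ^ (2 * e - 3) \<and>
    real m = (real q ^ (2 * e) - 1) / (real q - 1) \<and>
    real n = real q ^ (2 * e - 1)"
proof -
  interpret cring K by fact
  \<comment> \<open>Three ideals in number means that the listed ones are distinct.\<close>
  have "J \<noteq> {\<zero>\<^bsub>K\<^esub>}" "J \<noteq> carrier K"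
    using assms(5) unfolding assms(4) by (auto simp: card_insert_if split: if_splits)
  then interpret three_ideal_ring K J
    using assms by unfold_locales auto
  obtain h where "h \<in> ring_iso (K Quot J) F"
    using assms(10) by (auto simp: is_ring_iso_def)
  \<comment> \<open>Only the order of the residue field is taken from the isomorphism:
    \<open>q = |F| = |K/J| = |J|\<close>.\<close>
  then have "bij_betw h (a_rcosets\<^bsub>K\<^esub> J) (carrier F)"
    by (simp add: ring_iso_def FactRing_def)
  then have "q = card J"
    using bij_betw_same_card card_quotient assms(8) by metis
  with assms(1) show ?thesis by (rule Y_graph_divisible_design_graph)
qed

end
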